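(* Let $G\cong (0^{(k_1)},1^{(t_1)},\ldots,0^{(k_s)},1^{(t_s)})$ be a connected threshold graph on $n$ vertices with trace $T=\sum_{i=1}^s t_i$, and let $a_j=\max\{k_j-2,0\}$ for $j\in\{1,2,\ldots,s\}$. Then for any $q\in\{0,1,\ldots,s\}$, $$M_q(G)=Z_q(G)=T+\max_{1\le i_1<\cdots<i_q\le s}\ \sum_{j=1}^q a_{i_j}.$$
   Context: Graphs are finite, simple and undirected. Threshold graphs: a threshold graph on $n$ vertices is described by its creation sequence $(b_1,\dots,b_n)\in\{0,1\}^n$ with $b_1=0$: vertices $v_1,\dots,v_n$ are added one at a time; $v_i$ is added as an isolated vertex if $b_i=0$ and as a vertex adjacent to all previous vertices (dominating vertex) if $b_i=1$. We write $G\cong(b_1,\dots,b_n)$. The notation $(0^{(k_1)},1^{(t_1)},\ldots,0^{(k_s)},1^{(t_s)})$ means $k_1$ zeros, then $t_1$ ones, ..., then $k_s$ zeros, then $t_s$ ones, with $s\ge1$ and all $k_i,t_i\ge 1$ (the last entry is $1$, so $G$ is connected). The trace is the number of ones. For $q=0$ the maximum of the empty sum is $0$. $S(G)$ is the set of real symmetric $n\times n$ matrices whose off-diagonal $(i,j)$ entry is nonzero if and only if vertices $i$ and $j$ are adjacent (diagonal entries are arbitrary). $S_q(G)$ is the set of matrices in $S(G)$ with exactly $q$ negative eigenvalues (counting multiplicities), and $M_q(G)$ is the maximum nullity of a matrix in $S_q(G)$. Colour change rule (CCR): if a coloured vertex has exactly one uncoloured neighbour, that neighbour becomes coloured. $Z_q$-game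 ($q\ge 0$ an integer): initially all vertices of $G=(V,E)$ are uncoloured. The player repeatedly applies one of the following until all vertices are coloured: (1) for one token, colour any uncoloured vertex; (2) at no cost, apply the CCR on $G$; (3) if $B$ is the current set of coloured vertices and $W_1,\dots,W_k$ are the vertex sets of the components of $G[V\setminus B]$ with $k\ge q+1$, the player selects at least $q+1$ of the $W_i$'s and announces them to an oracle, the oracle returns a nonempty subset $\{W_{i_1},\dots,W_{i_\ell}\}$ of the selected ones, and at no cost the player can apply the CCR on $G[B\cup W_{i_1}\cup\cdots\cup W_{i_\ell}]$. $Z_q(G)$ is the minimum number of tokens needed to guarantee that all vertices can be coloured regardless of how the oracle responds. *)

theory Defs
  imports "HOL-Analysis.Analysis" "HOL-Computational_Algebra.Polynomial"
begin

section \<open>Graphs\<close>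

text \<open>
  A graph is given by its adjacency relation on a finite type \<open>'v\<close> whose elements
  are exactly the vertices, so that its matrices have type \<open>real^'v^'v\<close>.
\<close>

definition simple_graph :: "('v \<Rightarrow> 'v \<Rightarrow> bool) \<Rightarrow> bool" where
  "simple_graph E \<longleftrightarrow> symp E \<and> irreflp E"

definition induced_components :: "('v \<Rightarrow> 'v \<Rightarrow> bool) \<Rightarrow> 'v set \<Rightarrow> 'v set set" where
  "induced_components E U = {{y. (\<lambda>a b. a \<in> U \<and> b \<in> U \<and> E a b)\<^sup>*\<^sup>* x y} | x. x \<in> U}"

section \<open>Threshold graphs\<close>

text \<open>
  In a creation sequence \<open>True\<close> stands for 1 (dominating vertex) and \<open>False\<close> for 0
  (isolated vertex); entries are indexed from 0. The bijection \<open>v\<close> lists the vertices in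
  the order in which they are added: of two vertices, the later one decides whether
  they are adjacent.
\<close>

definition has_creation_sequence :: "('v \<Rightarrow> 'v \<Rightarrow> bool) \<Rightarrow> bool list \<Rightarrow> bool" where
  "has_creation_sequence E b \<longleftrightarrow>
     simple_graph E \<and> b \<noteq> [] \<and> \<not> b ! 0 \<and>
     (\<exists>v. bij_betw v {..<length b} UNIV \<and>
        (\<forall>i j. i < j \<and> j < length b \<longrightarrow> (E (v i) (v j) \<longleftrightarrow> b ! j)))"

definition block_sequence :: "nat \<Rightarrow> (nat \<Rightarrow> nat) \<Rightarrow> (nat \<Rightarrow> nat) \<Rightarrow> bool list" where
  "block_sequence s k t =
     concat (map (\<lambda>i. replicate (k i) False @ replicate (t i) True) [1..<Suc s])"

section \<open>Inertia-restricted maximum nullity\<close>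

definition symmetric_matrices_of :: "('v::finite \<Rightarrow> 'v \<Rightarrow> bool) \<Rightarrow> (real^'v^'v) set" where
  "symmetric_matrices_of E =
     {A. transpose A = A \<and> (\<forall>i j. i \<noteq> j \<longrightarrow> (A $ i $ j \<noteq> 0 \<longleftrightarrow> E i j))}"

definition charpoly :: "real^'v^'v \<Rightarrow> real poly" where
  "charpoly A = det (mat [:0, 1:] - (\<chi> i j. [:A $ i $ j:]))"

text \<open>The multiset \<open>proots p\<close> contains the roots of \<open>p\<close> with their multiplicities.\<close>

definition num_neg_eigenvalues :: "real^'v^'v \<Rightarrow> nat" where
  "num_neg_eigenvalues A = size (filter_mset (\<lambda>x. x < 0) (proots (charpoly A)))"

definition nullity :: "real^'v^'v \<Rightarrow> nat" where
  "nullity A = dim {x. A *v x = 0}"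

definition S_q :: "nat \<Rightarrow> ('v::finite \<Rightarrow> 'v \<Rightarrow> bool) \<Rightarrow> (real^'v^'v) set" where
  "S_q q E = {A \<in> symmetric_matrices_of E. num_neg_eigenvalues A = q}"

definition M_q :: "nat \<Rightarrow> ('v::finite \<Rightarrow> 'v \<Rightarrow> bool) \<Rightarrow> nat" where
  "M_q q E = Max (nullity ` S_q q E)"

section \<open>The zero forcing game\<close>

text \<open>
  One application of the colour change rule on the subgraph induced by \<open>U\<close>;
  \<open>B\<close> and \<open>B'\<close> are the sets of coloured vertices before and after.
\<close>

definition ccr :: "('v \<Rightarrow> 'v \<Rightarrow> bool) \<Rightarrow> 'v set \<Rightarrow> 'v set \<Rightarrow> 'v set \<Rightarrow> bool" where
  "ccr E U B B' \<longleftrightarrow>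
     (\<exists>u \<in> B \<inter> U. \<exists>w. {x \<in> U. E u x \<and> x \<notin> B} = {w} \<and> B' = insert w B)"

text \<open>
  \<open>Zq_win q E m B\<close>: from the set \<open>B\<close> of coloured vertices the player can guarantee,
  against every oracle, to colour all vertices using at most \<open>m\<close> further tokens. Being
  inductive, the predicate only admits strategies that terminate. In rule \<open>select\<close>,
  \<open>\<W>\<close> is the announced selection and \<open>R\<close> the oracle's answer, after which the
  player may apply the colour change rule any number of times on \<open>G[B \<union> \<Union>R]\<close>.
\<close>

inductive Zq_win :: "nat \<Rightarrow> ('v \<Rightarrow> 'v \<Rightarrow> bool) \<Rightarrow> nat \<Rightarrow> 'v set \<Rightarrow> bool"
  for q :: nat and E :: "'v \<Rightarrow> 'v \<Rightarrow> bool" where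
  finished: "Zq_win q E m UNIV"
| token: "\<lbrakk>v \<notin> B; Zq_win q E m (insert v B)\<rbrakk> \<Longrightarrow> Zq_win q E (Suc m) B"
| force: "\<lbrakk>ccr E UNIV B B'; Zq_win q E m B'\<rbrakk> \<Longrightarrow> Zq_win q E m B"
| select: "\<lbrakk>\<W> \<subseteq> induced_components E (UNIV - B); card \<W> \<ge> q + 1;
            \<forall>R. R \<subseteq> \<W> \<and> R \<noteq> {} \<longrightarrow>
              (\<exists>B'. (ccr E (B \<union> \<Union>R))\<^sup>*\<^sup>* B B' \<and> Zq_win q E m B')\<rbrakk>
           \<Longrightarrow> Zq_win q E m B"

definition Z_q :: "nat \<Rightarrow> ('v::finite \<Rightarrow> 'v \<Rightarrow> bool) \<Rightarrow> nat" where
  "Z_q q E = (LEAST m. Zq_win q E m {})"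

end

theory Submission
  imports Defs
begin

text \<open>
  The value \<open>T + Max \<dots>\<close> is a lower bound for \<open>M_q\<close> and an upper bound for \<open>Z_q\<close>, and \<open>M_q \<le> Z_q\<close>
  holds for every graph. For the latter, \<open>m\<close> tokens suffice from \<open>B\<close> only if the kernel vectors
  vanishing on \<open>B\<close> form a space of dimension at most \<open>m\<close>: at an oracle move every such vector keeps
  vanishing on the newly coloured set for at least one answer, and a real vector space is not a
  finite union of proper subspaces. The lower bound comes from a Gram matrix for a form with \<open>q\<close>
  negative squares. For the upper bound, the player obtains all 1-vertices and one 0-vertex
  of each block for \<open>T\<close> tokens, plays one 0-vertex of each unfinished block against the oracle while
  more than \<open>q\<close> blocks are unfinished, and then buys all but one 0-vertex in each remaining block.
\<close>

section \<open>Inertia of real symmetric matrices\<close>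

text \<open>The summand \<open>k i - 2\<close> is a dimension count. The 0-vertices of a block are
  pairwise nonadjacent, so in a Gram representation their vectors are orthogonal. Nonzero vectors of
  this kind need one dimension each in a positive definite space, whereas a hyperbolic plane has an
  isotropic line that can hold all of them: 2 dimensions instead of \<open>k i\<close>, paid for by
  one negative square. With \<open>q\<close> negative squares, \<open>q\<close> blocks can be
  compressed in this way. The 1-vertices need no dimensions of their own. As the nullity is at least
  the number of vertices minus the dimensions used, it collects all 1-vertices and
  \<open>k i - 2\<close> from each compressed block. The game has the same account: of the
  0-vertices of a block left to be bought, one is coloured at the start in exchange for a 1-vertex
  and one is forced at the end. The obstacle in the construction is that all 1-vertices must have
  nonzero products with each other although the blocks contribute with different signs.\<close>

lemma underdetermined_system:
  fixes g :: "'a \<Rightarrow> 'b \<Rightarrow> real"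
  assumes "finite F" "finite J" "card F < card J"
  shows "\<exists>c. (\<exists>j\<in>J. c j \<noteq> 0) \<and> (\<forall>f\<in>F. (\<Sum>j\<in>J. c j * g f j) = 0)"
  using assms
proof (induction F arbitrary: J g rule: finite_induct)
  case empty
  then obtain j where "j \<in> J" by fastforce
  then show ?case by (intro exI[of _ "\<lambda>_. 1"]) auto
next
  case (insert f F)
  show ?case
  proof (cases "\<forall>j\<in>J. g f j = 0")
    case True
    have "card F < card J" using insert.prems insert.hyps by simp
    then obtain c where "\<exists>j\<in>J. c j \<noteq> 0" "\<forall>h\<in>F. (\<Sum>j\<in>J. c j * g h j) = 0"
      using insert.IH insert.prems by blast
    then show ?thesis using True by auto
  next
    case False
    then obtain p where p: "p \<in> J" "g f p \<noteq> 0" by blast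
    define J' where "J' = J - {p}"
    have J: "J = insert p J'" "p \<notin> J'" "finite J'"
      using p insert.prems by (auto simp: J'_def)
    obtain c where c: "\<exists>j\<in>J'. c j \<noteq> 0"
      "\<forall>h\<in>F. (\<Sum>j\<in>J'. c j * (g h j - g f j / g f p * g h p)) = 0"
      using insert.IH[OF J(3), of "\<lambda>h j. g h j - g f j / g f p * g h p"] insert.prems insert.hyps J
      by auto
    define r where "r = - (\<Sum>j\<in>J'. c j * g f j) / g f p"
    define d where "d = c(p := r)"
    have sum_d: "(\<Sum>j\<in>J. d j * w j) = r * w p + (\<Sum>j\<in>J'. c j * w j)" for w
    proof -
      have "(\<Sum>j\<in>J'. d j * w j) = (\<Sum>j\<in>J'. c j * w j)"
        using J(2) by (intro sum.cong) (auto simp: d_def)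
      then show ?thesis using J by (simp add: d_def)
    qed
    have "(\<Sum>j\<in>J. d j * g h j) = 0" if "h \<in> F" for h
    proof -
      have "0 = (\<Sum>j\<in>J'. c j * g h j) - (\<Sum>j\<in>J'. c j * g f j) / g f p * g h p"
        using c(2) that by (simp add: right_diff_distrib sum_subtractf sum_divide_distrib sum_distrib_right mult.assoc)
      then show ?thesis by (simp add: sum_d r_def)
    qed
    moreover have "(\<Sum>j\<in>J. d j * g f j) = 0" using p by (simp add: sum_d r_def)
    moreover have "\<exists>j\<in>J. d j \<noteq> 0" using c(1) J by (auto simp: d_def)
    ultimately show ?thesis by blast
  qed
qed

text \<open>If \<open>x\<close> lies outside \<open>S\<close>, and \<open>y\<close> outside all
  members of \<open>\<F>\<close> and hence in \<open>S\<close>, then every point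
  \<open>x + n y\<close> avoids \<open>S\<close>. Two of these infinitely many points share a member
  of \<open>\<F>\<close>, which then contains a nonzero multiple of their direction
  \<open>y\<close>.\<close>

lemma subspace_subset_Union:
  fixes K :: "'a::real_vector set"
  assumes "finite \<F>" "subspace K" "\<forall>S\<in>\<F>. subspace S" "K \<subseteq> \<Union>\<F>"
  shows "\<exists>S\<in>\<F>. K \<subseteq> S"
  using assms
proof (induction \<F> rule: finite_induct)
  case empty
  then show ?case using subspace_0 by blast
next
  case (insert S \<F>)
  show ?case
  proof (rule ccontr)
    assume no: "\<not> (\<exists>S\<in>insert S \<F>. K \<subseteq> S)"
    then obtain x where x: "x \<in> K" "x \<notin> S" by blast
    have "\<not> K \<subseteq> \<Union>\<F>" using no insert by auto
    then obtain y where y: "y \<in> K" "y \<notin> \<Union>\<F>" by blast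
    then have yS: "y \<in> S" using insert.prems by blast
    have S: "subspace S" using insert.prems by blast
    have "\<exists>T\<in>\<F>. x + real n *\<^sub>R y \<in> T" for n
    proof -
      have "x + real n *\<^sub>R y \<notin> S"
        using x yS S by (metis add_diff_cancel subspace_diff subspace_scale)
      moreover have "x + real n *\<^sub>R y \<in> K"
        using x y insert.prems by (simp add: subspace_add subspace_scale)
      ultimately show ?thesis using insert.prems by blast
    qed
    then obtain T where T: "\<And>n. T n \<in> \<F>" "\<And>n. x + real n *\<^sub>R y \<in> T n" by metis
    have "\<not> inj T"
      using T(1) insert.hyps(1) by (meson finite_imageD finite_subset image_subsetI infinite_UNIV_nat)
    then obtain m n where mn: "T m = T n" "m \<noteq> n" by (auto simp: inj_def)
    have sT: "subspace (T n)" using T insert.prems by blast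
    have "(x + real m *\<^sub>R y) - (x + real n *\<^sub>R y) \<in> T n"
      using T(2)[of m] T(2)[of n] mn(1) sT by (metis subspace_diff)
    then have "(real m - real n) *\<^sub>R y \<in> T n" by (simp add: algebra_simps)
    then have "(1 / (real m - real n)) *\<^sub>R (real m - real n) *\<^sub>R y \<in> T n"
      using sT subspace_scale by blast
    then have "y \<in> T n" using mn by simp
    then show False using y T by blast
  qed
qed

lemma dim_Int_hyperplanes:
  fixes S :: "'a::euclidean_space set"
  assumes "subspace S" "finite F"
  shows "dim S \<le> dim (S \<inter> {x. \<forall>f\<in>F. f \<bullet> x = 0}) + card F"
  using assms(2)
proof (induction F rule: finite_induct)
  case empty
  then show ?case by simp
next
  case (insert f F)
  let ?S = "S \<inter> {x. \<forall>f\<in>F. f \<bullet> x = 0}"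
  have sub: "subspace ?S"
    using assms(1) by (auto simp: subspace_def inner_right_distrib)
  have eq: "S \<inter> {x. \<forall>f\<in>insert f F. f \<bullet> x = 0} = ?S \<inter> {x. f \<bullet> x = 0}" by auto
  have "dim ?S \<le> dim (?S \<inter> {x. f \<bullet> x = 0}) + 1"
  proof (cases "f = 0")
    case False
    have "dim {x + y |x y. x \<in> ?S \<and> y \<in> {x. f \<bullet> x = 0}} + dim (?S \<inter> {x. f \<bullet> x = 0})
       = dim ?S + dim {x. f \<bullet> x = 0}"
      by (rule dim_sums_Int[OF sub subspace_hyperplane])
    moreover have "dim {x. f \<bullet> x = 0} = DIM('a) - 1" using False by (rule dim_hyperplane)
    moreover have "dim {x + y |x y. x \<in> ?S \<and> y \<in> {x. f \<bullet> x = 0}} \<le> DIM('a)" by (rule dim_subset_UNIV)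
    ultimately show ?thesis using DIM_positive[where 'a='a] by linarith
  qed simp
  then show ?case unfolding eq using insert.IH insert.hyps by simp
qed

section \<open>The spectral theorem for real symmetric matrices\<close>

lemma symmetric_inner_swap:
  fixes A :: "real^'n^'n"
  assumes "transpose A = A"
  shows "x \<bullet> (A *v y) = (A *v x) \<bullet> y"
  using assms by (metis dot_lmul_matrix vector_transpose_matrix)

text \<open>A first-order condition without derivatives: the polynomial has its minimum at
  0.\<close>

lemma quadratic_nonneg_imp_linear_coeff_0:
  fixes b c :: real
  assumes "\<And>t. 0 \<le> 2 * t * b + t^2 * c"
  shows "b = 0"
proof (rule ccontr)
  assume b: "b \<noteq> 0"
  have c: "0 \<le> c" using assms[of 1] assms[of "-1"] by simp
  \<comment> \<open>The minimiser would be \<open>- b / c\<close>; \<open>c + 1\<close> avoids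
    division by 0 and still gives a negative value.\<close>
  define u where "u = b / (c + 1)"
  have u: "b = u * (c + 1)" using c by (simp add: u_def)
  then have "u \<noteq> 0" using b by auto
  have "0 \<le> 2 * (- u) * b + (- u)^2 * c" by (rule assms)
  also have "\<dots> = u^2 * (- c - 2)" unfolding u by (simp add: algebra_simps power2_eq_square)
  also have "\<dots> < 0" using \<open>u \<noteq> 0\<close> c by (intro mult_pos_neg) auto
  finally show False by simp
qed

text \<open>The maximiser of the Rayleigh quotient on an invariant subspace is an eigenvector.\<close>

lemma symmetric_eigenvector_exists:
  fixes A :: "real^'n^'n"
  assumes A: "transpose A = A" and S: "subspace S" "\<And>x. x \<in> S \<Longrightarrow> A *v x \<in> S"
    and ne: "S \<noteq> {0}"
  obtains v l where "v \<in> S" "norm v = 1" "A *v v = l *\<^sub>R v"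
proof -
  let ?C = "S \<inter> sphere 0 1"
  have comp: "compact ?C"
    using S(1) by (simp add: closed_Int_compact closed_subspace)
  have nonempty: "?C \<noteq> {}"
  proof -
    obtain x where x: "x \<in> S" "x \<noteq> 0" using ne S(1) subspace_0 by blast
    then have "(1 / norm x) *\<^sub>R x \<in> ?C" using S(1) by (simp add: subspace_scale)
    then show ?thesis by blast
  qed
  have "continuous_on ?C (\<lambda>x. x \<bullet> (A *v x))"
    by (intro continuous_intros linear_continuous_on matrix_vector_mul_bounded_linear)
  from continuous_attains_sup[OF comp nonempty this]
  obtain v where v: "v \<in> ?C" "\<And>y. y \<in> ?C \<Longrightarrow> y \<bullet> (A *v y) \<le> v \<bullet> (A *v v)"
    by blast
  define l where "l = v \<bullet> (A *v v)"
  have vv: "v \<bullet> v = 1" using v by (simp add: norm_eq_1)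
  have vS: "v \<in> S" using v by simp
  have le: "0 \<le> l * (y \<bullet> y) - y \<bullet> (A *v y)" if "y \<in> S" for y
  proof (cases "y = 0")
    case False
    let ?u = "(1 / norm y) *\<^sub>R y"
    have "?u \<in> ?C" using S(1) that False by (simp add: subspace_scale)
    then have "?u \<bullet> (A *v ?u) \<le> l" using v l_def by blast
    then have "(y \<bullet> (A *v y)) / (norm y)^2 \<le> l"
      by (simp add: matrix_vector_mult_scaleR power2_eq_square)
    then show ?thesis using False
      by (simp add: divide_le_eq dot_square_norm)
  qed simp
  \<comment> \<open>The form in \<open>le\<close> is nonnegative on \<open>S\<close> and vanishes at
    \<open>v\<close>, so its linear term at \<open>v\<close> in direction \<open>y\<close> is
    0.\<close>
  have orth: "l * (v \<bullet> y) - y \<bullet> (A *v v) = 0" if y: "y \<in> S" for y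
  proof (rule quadratic_nonneg_imp_linear_coeff_0)
    fix r :: real
    have "v + r *\<^sub>R y \<in> S" using vS y S(1) by (simp add: subspace_add subspace_scale)
    from le[OF this]
    have "0 \<le> l * ((v + r *\<^sub>R y) \<bullet> (v + r *\<^sub>R y)) - (v + r *\<^sub>R y) \<bullet> (A *v (v + r *\<^sub>R y))" .
    also have "(v + r *\<^sub>R y) \<bullet> (A *v (v + r *\<^sub>R y))
        = l + 2 * r * (y \<bullet> (A *v v)) + r^2 * (y \<bullet> (A *v y))"
      using symmetric_inner_swap[OF A, of v y]
      by (simp add: l_def matrix_vector_right_distrib matrix_vector_mult_scaleR inner_left_distrib
          inner_right_distrib power2_eq_square algebra_simps inner_commute)
    also have "(v + r *\<^sub>R y) \<bullet> (v + r *\<^sub>R y) = 1 + 2 * r * (v \<bullet> y) + r^2 * (y \<bullet> y)"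
      using vv by (simp add: inner_left_distrib inner_right_distrib power2_eq_square inner_commute algebra_simps)
    finally show "0 \<le> 2 * r * (l * (v \<bullet> y) - y \<bullet> (A *v v)) + r^2 * (l * (y \<bullet> y) - y \<bullet> (A *v y))"
      by (simp add: algebra_simps)
  qed
  \<comment> \<open>By \<open>orth\<close> the residual is orthogonal to all of \<open>S\<close>; by
    invariance it lies in \<open>S\<close>, so it is orthogonal to itself.\<close>
  let ?d = "l *\<^sub>R v - A *v v"
  have "?d \<in> S" using S vS by (simp add: subspace_diff subspace_scale)
  from orth[OF this] have "?d \<bullet> ?d = 0"
    by (simp add: inner_diff_left inner_diff_right inner_commute algebra_simps)
  then have "A *v v = l *\<^sub>R v" by simp
  then show thesis using that[of v l] v(1) by simp
qed

text \<open>Invariant subspaces make the induction possible: by symmetry the part of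
  \<open>S\<close> orthogonal to one eigenvector is invariant again.\<close>

lemma symmetric_eigenbasis_subspace:
  fixes A :: "real^'n^'n"
  assumes A: "transpose A = A" and "subspace S" "\<And>x. x \<in> S \<Longrightarrow> A *v x \<in> S"
  shows "\<exists>B. B \<subseteq> S \<and> pairwise orthogonal B \<and> (\<forall>v\<in>B. norm v = 1 \<and> (\<exists>l. A *v v = l *\<^sub>R v)) \<and> span B = S"
  using assms(2,3)
proof (induction "dim S" arbitrary: S rule: less_induct)
  case less
  show ?case
  proof (cases "S = {0}")
    case True
    then show ?thesis by (intro exI[of _ "{}"]) (auto simp: pairwise_def)
  next
    case False
    obtain v l where v: "v \<in> S" "norm v = 1" "A *v v = l *\<^sub>R v"
      using symmetric_eigenvector_exists[OF A less.prems False] .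
    have vv: "v \<bullet> v = 1" using v by (simp add: norm_eq_1)
    let ?S = "S \<inter> {x. v \<bullet> x = 0}"
    have sub: "subspace ?S" using less.prems(1) by (simp add: subspace_inter subspace_hyperplane)
    have inv: "A *v x \<in> ?S" if "x \<in> ?S" for x
      using that less.prems(2) symmetric_inner_swap[OF A, of v x] v by simp
    have "v \<notin> ?S" using vv by simp
    then have "?S \<subset> S" using v(1) by blast
    then have "dim ?S < dim S"
      using sub less.prems(1) by (metis dim_psubset span_eq_iff)
    from less.hyps[OF this sub inv]
    obtain B where B: "B \<subseteq> ?S" "pairwise orthogonal B"
      "\<forall>v\<in>B. norm v = 1 \<and> (\<exists>l. A *v v = l *\<^sub>R v)" "span B = ?S" by blast
    have "S \<subseteq> span (insert v B)"
    proof
      fix x assume x: "x \<in> S"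
      have "x - (v \<bullet> x) *\<^sub>R v \<in> ?S"
        using x v vv less.prems(1) by (simp add: subspace_diff subspace_scale inner_diff_right)
      then show "x \<in> span (insert v B)" using B(4) by (auto simp: span_insert)
    qed
    moreover have "span (insert v B) \<subseteq> S"
      using v B less.prems(1) by (intro span_minimal) auto
    moreover have "pairwise orthogonal (insert v B)"
      using B by (auto simp: pairwise_insert orthogonal_def inner_commute)
    ultimately show ?thesis using v B by (intro exI[of _ "insert v B"]) auto
  qed
qed

text \<open>Indexing the basis by the index type of the matrix lets the eigenvectors be the columns
  of a square matrix.\<close>

lemma symmetric_eigenbasis:
  fixes A :: "real^'n^'n"
  assumes A: "transpose A = A"
  obtains e :: "'n \<Rightarrow> real^'n" and l where
    "\<And>i j. e i \<bullet> e j = (if i = j then 1 else 0)" "\<And>i. A *v e i = l i *\<^sub>R e i"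
proof -
  obtain B where B: "pairwise orthogonal B"
    "\<forall>v\<in>B. norm v = 1 \<and> (\<exists>l. A *v v = l *\<^sub>R v)" "span B = (UNIV :: (real^'n) set)"
    using symmetric_eigenbasis_subspace[OF A subspace_UNIV] by blast
  have ind: "independent B"
    using B by (intro pairwise_orthogonal_independent) auto
  then have fin: "finite B" by (rule independent_imp_finite)
  have "card B = dim (UNIV :: (real^'n) set)"
    using ind B(3) by (metis dim_span_eq_card_independent)
  then have "card (UNIV :: 'n set) = card B" by simp
  then obtain e where e: "bij_betw e (UNIV :: 'n set) B"
    using fin by (meson finite_class.finite_UNIV finite_same_card_bij)
  have eB: "e i \<in> B" for i using e by (auto simp: bij_betw_def)
  then have "\<forall>i. \<exists>l. A *v e i = l *\<^sub>R e i" using B(2) by blast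
  then obtain l where "\<And>i. A *v e i = l i *\<^sub>R e i" by metis
  moreover have "e i \<bullet> e j = (if i = j then 1 else 0)" for i j
  proof (cases "i = j")
    case True
    then show ?thesis using B(2) eB norm_eq_1 by auto
  next
    case False
    then have "e i \<noteq> e j" using e by (auto simp: bij_betw_def inj_def)
    then show ?thesis using False B(1) eB by (auto simp: pairwise_def orthogonal_def)
  qed
  ultimately show thesis using that by blast
qed

section \<open>The characteristic polynomial and the number of negative eigenvalues\<close>

definition const_poly_matrix :: "real^'n^'m \<Rightarrow> real poly^'n^'m" where
  "const_poly_matrix A = (\<chi> i j. [:A $ i $ j:])"

lemma const_poly_sum: "[:\<Sum>i\<in>I. f i:] = (\<Sum>i\<in>I. [:f i::real:])"
proof (induction I rule: infinite_finite_induct)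
  case (insert x I)
  have "[:f x + sum f I:] = [:f x:] + [:sum f I:]" by simp
  then show ?case using insert by simp
qed simp_all

lemma const_poly_matrix_mult:
  "const_poly_matrix (A ** B) = const_poly_matrix A ** const_poly_matrix B"
  by (simp add: const_poly_matrix_def matrix_matrix_mult_def const_poly_sum vec_eq_iff mult.commute)

lemma const_poly_matrix_mat1: "const_poly_matrix (mat 1 :: real^'n^'n) = mat 1"
  by (simp add: const_poly_matrix_def mat_def vec_eq_iff)

lemma mat_commute:
  fixes M :: "'a::comm_semiring_1^'n^'n"
  shows "mat c ** M = M ** mat c"
  by (simp add: vec_eq_iff matrix_matrix_mult_def mat_def if_distrib if_distribR cong: if_cong)
     (simp add: mult.commute)

lemma matrix_diff_ldistrib:
  fixes A :: "'a::ring_1^'n^'m"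
  shows "A ** (B - C) = A ** B - A ** C"
  by (simp add: vec_eq_iff matrix_matrix_mult_def right_diff_distrib sum_subtractf)

lemma matrix_diff_rdistrib:
  fixes A :: "'a::ring_1^'n^'m"
  shows "(A - B) ** C = A ** C - B ** C"
  by (simp add: vec_eq_iff matrix_matrix_mult_def left_diff_distrib sum_subtractf)

text \<open>The conjugation is carried out over the polynomial ring, where
  \<open>mat [:0, 1:]\<close> commutes with every matrix and is therefore fixed.\<close>

lemma charpoly_similar:
  fixes A P Q :: "real^'n^'n"
  assumes "P ** Q = mat 1"
  shows "charpoly (P ** A ** Q) = charpoly A"
proof -
  let ?c = "const_poly_matrix :: real^'n^'n \<Rightarrow> _"
  have PQ: "?c P ** ?c Q = mat 1"
    using assms by (metis const_poly_matrix_mult const_poly_matrix_mat1)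
  have "mat [:0, 1:] - ?c (P ** A ** Q) = ?c P ** (mat [:0, 1:] - ?c A) ** ?c Q"
  proof -
    have "?c P ** mat [:0, 1:] ** ?c Q = mat [:0, 1:]"
      by (metis PQ mat_commute matrix_mul_assoc matrix_mul_rid)
    then show ?thesis
      by (simp add: const_poly_matrix_mult matrix_diff_ldistrib matrix_diff_rdistrib)
  qed
  moreover have "det (?c P) * det (?c Q) = 1"
    by (metis PQ det_I det_mul)
  ultimately show ?thesis
    unfolding charpoly_def const_poly_matrix_def[symmetric]
    by (simp add: det_mul mult.commute mult.left_commute)
qed

text \<open>The bridge from roots with multiplicity to an eigenbasis; everything later about
  negative eigenvalues rests on the latter.\<close>

lemma num_neg_eigenvalues_eigenbasis:
  fixes A :: "real^'n^'n" and e :: "'n \<Rightarrow> real^'n"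
  assumes e: "\<And>i j. e i \<bullet> e j = (if i = j then 1 else 0)" and l: "\<And>i. A *v e i = l i *\<^sub>R e i"
  shows "num_neg_eigenvalues A = card {i. l i < 0}"
proof -
  define Q :: "real^'n^'n" where "Q = (\<chi> i j. e j $ i)"
  define D :: "real^'n^'n" where "D = (\<chi> i j. if i = j then l i else 0)"
  have PQ: "transpose Q ** Q = mat 1"
    using e by (simp add: Q_def transpose_def matrix_matrix_mult_def mat_def vec_eq_iff inner_vec_def)
  have AQ: "A ** Q = Q ** D"
  proof -
    have "(\<Sum>k\<in>UNIV. A $ i $ k * e j $ k) = l j * e j $ i" for i j
      using arg_cong[OF l[of j], of "\<lambda>x. x $ i"] by (simp add: matrix_vector_mult_def)
    then show ?thesis
      by (simp add: Q_def D_def matrix_matrix_mult_def vec_eq_iff if_distrib if_distribR mult.commute cong: if_cong)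
  qed
  have "transpose Q ** A ** Q = D"
    using AQ PQ by (metis matrix_mul_assoc matrix_mul_lid)
  then have "charpoly A = charpoly D"
    using charpoly_similar[OF PQ, of A] by simp
  also have "\<dots> = (\<Prod>i\<in>UNIV. [:- l i, 1:])"
    unfolding charpoly_def D_def by (subst det_diagonal) (auto simp: mat_def)
  finally have "proots (charpoly A) = (\<Sum>i\<in>UNIV. {#l i#})"
    by (simp add: proots_prod)
  moreover have "size (filter_mset (\<lambda>x. x < 0) (\<Sum>i\<in>I. {#l i#})) = card {i\<in>I. l i < 0}"
    if "finite I" for I
    using that
  proof (induction I rule: finite_induct)
    case (insert i I)
    have "{j \<in> insert i I. l j < 0} = (if l i < 0 then insert i {j\<in>I. l j < 0} else {j\<in>I. l j < 0})"
      by auto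
    then show ?case using insert by simp
  qed simp
  ultimately show ?thesis unfolding num_neg_eigenvalues_def by simp
qed

section \<open>Negative eigenvalues and the quadratic form\<close>

lemma orthonormal_expansion:
  fixes e :: "'n \<Rightarrow> real^'n"
  assumes e: "\<And>i j. e i \<bullet> e j = (if i = j then 1 else 0)"
  shows "x = (\<Sum>k\<in>UNIV. (x \<bullet> e k) *\<^sub>R e k)"
proof -
  define Q :: "real^'n^'n" where "Q = (\<chi> i j. e j $ i)"
  have "transpose Q ** Q = mat 1"
    using e by (simp add: Q_def transpose_def matrix_matrix_mult_def mat_def vec_eq_iff inner_vec_def)
  \<comment> \<open>Orthonormality makes the transpose a left inverse; that it is a right inverse as
    well is the expansion.\<close>
  then have "Q ** transpose Q = mat 1" by (simp add: matrix_left_right_inverse)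
  then have QQ: "Q *v (transpose Q *v x) = x"
    by (metis matrix_vector_mul_assoc matrix_vector_mul_lid)
  have "transpose Q *v x = (\<chi> k. x \<bullet> e k)"
    by (simp add: Q_def transpose_def matrix_vector_mult_def inner_vec_def mult.commute)
  then have "(Q *v (transpose Q *v x)) $ i = (\<Sum>k\<in>UNIV. (x \<bullet> e k) *\<^sub>R e k) $ i" for i
    by (simp only:) (simp add: matrix_vector_mult_def Q_def mult.commute)
  then show ?thesis using QQ by (simp add: vec_eq_iff)
qed

lemma orthonormal_parseval:
  fixes e :: "'n \<Rightarrow> real^'n"
  assumes e: "\<And>i j. e i \<bullet> e j = (if i = j then 1 else 0)"
  shows "x \<bullet> y = (\<Sum>k\<in>UNIV. (x \<bullet> e k) * (y \<bullet> e k))"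
proof -
  have "x \<bullet> y = (\<Sum>k\<in>UNIV. (x \<bullet> e k) *\<^sub>R e k) \<bullet> y"
    using orthonormal_expansion[OF e, of x] by simp
  also have "\<dots> = (\<Sum>k\<in>UNIV. (x \<bullet> e k) * (e k \<bullet> y))" by (simp add: inner_sum_left)
  finally show ?thesis by (simp add: inner_commute[of y])
qed

lemma eigenbasis_inner:
  fixes A :: "real^'n^'n" and e :: "'n \<Rightarrow> real^'n"
  assumes "transpose A = A" "\<And>i. A *v e i = l i *\<^sub>R e i"
  shows "(A *v x) \<bullet> e i = l i * (x \<bullet> e i)"
  unfolding symmetric_inner_swap[OF assms(1), symmetric] assms(2) by simp

lemma eigenbasis_quadratic_form:
  fixes A :: "real^'n^'n" and e :: "'n \<Rightarrow> real^'n"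
  assumes "transpose A = A"
    and "\<And>i j. e i \<bullet> e j = (if i = j then 1 else 0)" "\<And>i. A *v e i = l i *\<^sub>R e i"
  shows "x \<bullet> (A *v x) = (\<Sum>i\<in>UNIV. l i * (x \<bullet> e i)^2)"
  by (subst orthonormal_parseval[OF assms(2)])
     (simp add: eigenbasis_inner[of A e l, OF assms(1,3)] power2_eq_square mult_ac)

text \<open>There are more coefficients than negative eigenvectors, so some nontrivial choice makes
  the combination orthogonal to all of these. There every term
  \<open>l i * (y \<bullet> e i)^2\<close> is nonnegative, so an isotropic vector has all terms 0
  and lies in the kernel. The claim concerns the coefficients, since some vectors of the family may
  be 0.\<close>

lemma nonneg_combination_of_many_vectors:
  fixes A :: "real^'n^'n" and x :: "'b \<Rightarrow> real^'n"
  assumes A: "transpose A = A" and J: "finite J" "num_neg_eigenvalues A < card J"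
  obtains c where "\<exists>j\<in>J. c j \<noteq> 0"
    "0 \<le> (\<Sum>j\<in>J. c j *\<^sub>R x j) \<bullet> (A *v (\<Sum>j\<in>J. c j *\<^sub>R x j))"
    "(\<Sum>j\<in>J. c j *\<^sub>R x j) \<bullet> (A *v (\<Sum>j\<in>J. c j *\<^sub>R x j)) = 0 \<Longrightarrow>
     A *v (\<Sum>j\<in>J. c j *\<^sub>R x j) = 0"
proof -
  obtain e :: "'n \<Rightarrow> real^'n" and l where e: "\<And>i j. e i \<bullet> e j = (if i = j then 1 else 0)"
    and l: "\<And>i. A *v e i = l i *\<^sub>R e i"
    using symmetric_eigenbasis[OF A] by blast
  have "card {i. l i < 0} < card J"
    using J num_neg_eigenvalues_eigenbasis[OF e l] by simp
  then obtain c where c: "\<exists>j\<in>J. c j \<noteq> 0"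
    "\<forall>i\<in>{i. l i < 0}. (\<Sum>j\<in>J. c j * (x j \<bullet> e i)) = 0"
    using underdetermined_system[of "{i. l i < 0}" J "\<lambda>i j. x j \<bullet> e i"] J(1) by auto
  define y where "y = (\<Sum>j\<in>J. c j *\<^sub>R x j)"
  have "y \<bullet> e i = 0" if "l i < 0" for i
    using c(2) that by (simp add: y_def inner_sum_left)
  then have nn: "0 \<le> l i * (y \<bullet> e i)^2" for i
    by (cases "l i < 0") auto
  note form = eigenbasis_quadratic_form[OF A e l, of y]
  have "0 \<le> y \<bullet> (A *v y)" unfolding form by (intro sum_nonneg nn)
  moreover have "A *v y = 0" if "y \<bullet> (A *v y) = 0"
  proof -
    have "\<forall>i\<in>UNIV. l i * (y \<bullet> e i)^2 = 0"
      using that unfolding form by (subst (asm) sum_nonneg_eq_0_iff) (auto simp: nn)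
    then have "(A *v y) \<bullet> e i = 0" for i
      using eigenbasis_inner[where e=e, OF A l] by auto
    then have "(A *v y) \<bullet> (A *v y) = 0"
      by (subst orthonormal_parseval[OF e]) simp
    then show ?thesis by simp
  qed
  ultimately show thesis using that c(1) unfolding y_def by blast
qed

text \<open>Otherwise the span of the negative eigenvectors would contain a nonzero vector
  satisfying the \<open>card F\<close> equations, and the form is negative there.\<close>

lemma num_neg_eigenvalues_le:
  fixes A :: "real^'n^'n" and h :: "'b \<Rightarrow> real^'n"
  assumes A: "transpose A = A" and F: "finite F"
    and nonneg: "\<And>x. (\<And>f. f \<in> F \<Longrightarrow> h f \<bullet> x = 0) \<Longrightarrow> 0 \<le> x \<bullet> (A *v x)"
  shows "num_neg_eigenvalues A \<le> card F"
proof (rule ccontr)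
  assume less: "\<not> num_neg_eigenvalues A \<le> card F"
  obtain e :: "'n \<Rightarrow> real^'n" and l where e: "\<And>i j. e i \<bullet> e j = (if i = j then 1 else 0)"
    and l: "\<And>i. A *v e i = l i *\<^sub>R e i"
    using symmetric_eigenbasis[OF A] by blast
  let ?N = "{i. l i < 0}"
  have "card F < card ?N"
    using less num_neg_eigenvalues_eigenbasis[OF e l] by simp
  then obtain c where c: "\<exists>i\<in>?N. c i \<noteq> 0" "\<forall>f\<in>F. (\<Sum>i\<in>?N. c i * (h f \<bullet> e i)) = 0"
    using underdetermined_system[of F ?N "\<lambda>f i. h f \<bullet> e i"] F by auto
  define y where "y = (\<Sum>i\<in>?N. c i *\<^sub>R e i)"
  have y: "y \<bullet> e i = (if l i < 0 then c i else 0)" for i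
    by (simp add: y_def inner_sum_left e if_distrib cong: if_cong)
  have "0 \<le> y \<bullet> (A *v y)"
    using c(2) by (intro nonneg) (simp add: y_def inner_sum_right)
  also have "\<dots> = (\<Sum>i\<in>UNIV. l i * (y \<bullet> e i)^2)" by (rule eigenbasis_quadratic_form[OF A e l])
  also have "\<dots> < (\<Sum>i\<in>(UNIV::'n set). 0)"
  proof (rule sum_strict_mono_ex1)
    show "\<forall>i\<in>UNIV. l i * (y \<bullet> e i)^2 \<le> 0" by (auto simp: y mult_nonpos_nonneg)
    obtain i where "l i < 0" "c i \<noteq> 0" using c(1) by blast
    then have "l i * (y \<bullet> e i)^2 < 0" by (simp add: y mult_neg_pos)
    then show "\<exists>i\<in>UNIV. l i * (y \<bullet> e i)^2 < 0" by blast
  qed simp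
  finally show False by simp
qed

lemma num_neg_eigenvalues_ge:
  fixes A :: "real^'n^'n" and x :: "'b \<Rightarrow> real^'n"
  assumes A: "transpose A = A" and J: "finite J"
    and neg: "\<And>c. \<exists>j\<in>J. c j \<noteq> 0 \<Longrightarrow>
      (\<Sum>j\<in>J. c j *\<^sub>R x j) \<bullet> (A *v (\<Sum>j\<in>J. c j *\<^sub>R x j)) < 0"
  shows "card J \<le> num_neg_eigenvalues A"
proof (rule ccontr)
  assume "\<not> card J \<le> num_neg_eigenvalues A"
  then have "num_neg_eigenvalues A < card J" by simp
  then obtain c where "\<exists>j\<in>J. c j \<noteq> 0"
    "0 \<le> (\<Sum>j\<in>J. c j *\<^sub>R x j) \<bullet> (A *v (\<Sum>j\<in>J. c j *\<^sub>R x j))"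
    by (rule nonneg_combination_of_many_vectors[OF A J, where x = x])
  then show False using neg[of c] by simp
qed

text \<open>The form is nonnegative where all \<open>n i\<close> vanish and negative definite on the
  span of the \<open>y i\<close>, which fixes the count at \<open>card J\<close>. The common zeros
  of all \<open>p w\<close> and \<open>n i\<close> lie in the kernel, whence the bound on the
  nullity.\<close>

lemma signature_sum_of_squares:
  fixes p :: "'a \<Rightarrow> real^'v" and n :: "'b \<Rightarrow> real^'v"
  assumes fin: "finite P" "finite J"
    and pos: "\<And>w. w \<in> P \<Longrightarrow> 0 < \<alpha> w" "\<And>i. i \<in> J \<Longrightarrow> 0 < \<beta> i"
    and dual: "\<And>i w. i \<in> J \<Longrightarrow> w \<in> P \<Longrightarrow> p w \<bullet> y i = 0"
      "\<And>i j. i \<in> J \<Longrightarrow> j \<in> J \<Longrightarrow> n j \<bullet> y i = (if j = i then 1 else 0)"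
  defines "A \<equiv> \<chi> u v. (\<Sum>w\<in>P. \<alpha> w * (p w $ u * p w $ v)) - (\<Sum>i\<in>J. \<beta> i * (n i $ u * n i $ v))"
  shows "transpose A = A" "num_neg_eigenvalues A = card J"
    "CARD('v) \<le> nullity A + (card P + card J)"
proof -
  show sym: "transpose A = A"
    by (simp add: A_def transpose_def vec_eq_iff mult.commute)
  have mult: "A *v x = (\<Sum>w\<in>P. (\<alpha> w * (p w \<bullet> x)) *\<^sub>R p w) - (\<Sum>i\<in>J. (\<beta> i * (n i \<bullet> x)) *\<^sub>R n i)" for x
  proof -
    have swap: "(\<Sum>v\<in>UNIV. (\<Sum>w\<in>S. c w * (f w $ u * f w $ v)) * x $ v) = (\<Sum>w\<in>S. c w * (f w \<bullet> x) * f w $ u)"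
      for S :: "'c set" and c f u
    proof -
      have "(\<Sum>v\<in>UNIV. (\<Sum>w\<in>S. c w * (f w $ u * f w $ v)) * x $ v)
          = (\<Sum>w\<in>S. \<Sum>v\<in>UNIV. c w * (f w $ u * f w $ v) * x $ v)"
        unfolding sum_distrib_right by (rule sum.swap)
      then show ?thesis
        by (simp add: inner_vec_def sum_distrib_left sum_distrib_right mult_ac)
    qed
    show ?thesis
      unfolding vec_eq_iff
      by (simp add: A_def matrix_vector_mult_def left_diff_distrib sum_subtractf swap)
  qed
  have form: "x \<bullet> (A *v x) = (\<Sum>w\<in>P. \<alpha> w * (p w \<bullet> x)^2) - (\<Sum>i\<in>J. \<beta> i * (n i \<bullet> x)^2)" for x
    unfolding mult inner_diff_right inner_sum_right inner_scaleR_right inner_commute[of x]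
    by (simp add: power2_eq_square mult.assoc)
  have "num_neg_eigenvalues A \<le> card J"
  proof (rule num_neg_eigenvalues_le[OF sym fin(2)])
    fix x assume "\<And>i. i \<in> J \<Longrightarrow> n i \<bullet> x = 0"
    then show "0 \<le> x \<bullet> (A *v x)"
      unfolding form using pos by (simp add: sum_nonneg less_imp_le)
  qed
  moreover have "card J \<le> num_neg_eigenvalues A"
  proof (rule num_neg_eigenvalues_ge[OF sym fin(2)])
    fix c :: "'b \<Rightarrow> real" assume c: "\<exists>j\<in>J. c j \<noteq> 0"
    let ?x = "\<Sum>j\<in>J. c j *\<^sub>R y j"
    have "p w \<bullet> ?x = 0" if "w \<in> P" for w
      using dual(1) that by (simp add: inner_sum_right)
    moreover have nx: "n i \<bullet> ?x = c i" if "i \<in> J" for i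
    proof -
      have "n i \<bullet> ?x = (\<Sum>j\<in>J. if i = j then c j else 0)"
        unfolding inner_sum_right using dual(2) that by (intro sum.cong) auto
      then show ?thesis using fin that by simp
    qed
    ultimately have "?x \<bullet> (A *v ?x) = - (\<Sum>i\<in>J. \<beta> i * (c i)^2)"
      unfolding form by simp
    also have "\<dots> < 0"
    proof -
      obtain j where j: "j \<in> J" "c j \<noteq> 0" using c by blast
      then have "0 < \<beta> j * (c j)^2" using pos by simp
      then have "0 < (\<Sum>i\<in>J. \<beta> i * (c i)^2)"
        using fin pos j by (intro sum_pos2[of J j]) (auto simp: less_imp_le)
      then show ?thesis by simp
    qed
    finally show "?x \<bullet> (A *v ?x) < 0" .
  qed
  ultimately show "num_neg_eigenvalues A = card J" by simp
  let ?F = "p ` P \<union> n ` J"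
  have "UNIV \<inter> {x. \<forall>f\<in>?F. f \<bullet> x = 0} \<subseteq> {x. A *v x = 0}"
    by (auto simp: mult)
  then have "dim (UNIV \<inter> {x. \<forall>f\<in>?F. f \<bullet> x = 0}) \<le> nullity A"
    unfolding nullity_def by (rule dim_subset)
  moreover have "dim (UNIV :: (real^'v) set) \<le> dim (UNIV \<inter> {x. \<forall>f\<in>?F. f \<bullet> x = 0}) + card ?F"
    using fin by (intro dim_Int_hyperplanes) auto
  moreover have "card ?F \<le> card P + card J"
    using card_Un_le[of "p ` P" "n ` J"] card_image_le[OF fin(1), of p] card_image_le[OF fin(2), of n]
    by linarith
  ultimately show "CARD('v) \<le> nullity A + (card P + card J)" by simp
qed

section \<open>Nullity and the zero forcing game\<close>

definition zero_kernel :: "real^'v^'v \<Rightarrow> 'v set \<Rightarrow> (real^'v) set" where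
  "zero_kernel A B = {x. A *v x = 0 \<and> (\<forall>v\<in>B. x $ v = 0)}"

lemma subspace_zero_kernel: "subspace (zero_kernel A B)"
  by (simp add: zero_kernel_def subspace_def matrix_vector_right_distrib matrix_vector_mult_scaleR)

lemma symmetric_matrices_of_nonzero_iff:
  "A \<in> symmetric_matrices_of E \<Longrightarrow> i \<noteq> j \<Longrightarrow> A $ i $ j \<noteq> 0 \<longleftrightarrow> E i j"
  by (simp add: symmetric_matrices_of_def)

lemma symmetric_matrices_of_sym:
  "A \<in> symmetric_matrices_of E \<Longrightarrow> E i j \<Longrightarrow> E j i"
proof (cases "i = j")
  case False
  assume A: "A \<in> symmetric_matrices_of E" and "E i j"
  then have "A $ i $ j \<noteq> 0" using symmetric_matrices_of_nonzero_iff[OF A, of i j] False by simp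
  moreover have "transpose A $ j $ i = A $ j $ i" using A by (simp add: symmetric_matrices_of_def)
  ultimately have "A $ j $ i \<noteq> 0" by (simp add: transpose_def)
  then show "E j i" using symmetric_matrices_of_nonzero_iff[OF A, of j i] False by simp
qed simp

text \<open>In row \<open>u\<close> of \<open>A *v y = 0\<close> only the term at \<open>w\<close>
  survives: the other neighbours of \<open>u\<close> lie in \<open>B\<close> or outside
  \<open>U\<close>, and the diagonal term is 0 because \<open>u\<close> is in \<open>B\<close>.
  Vanishing outside \<open>U\<close> is what makes forcing on an induced subgraph as good as forcing
  on the whole graph.\<close>

lemma ccr_vanishing:
  fixes A :: "real^'v::finite^'v"
  assumes A: "A \<in> symmetric_matrices_of E" and "ccr E U B B'"
    and y: "A *v y = 0" "\<forall>v\<in>B. y $ v = 0" "\<forall>v. v \<notin> U \<longrightarrow> y $ v = 0"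
  shows "\<forall>v\<in>B'. y $ v = 0"
proof -
  obtain u w where u: "u \<in> B" "{x \<in> U. E u x \<and> x \<notin> B} = {w}" "B' = insert w B"
    using assms(2) unfolding ccr_def by blast
  have "0 = (\<Sum>v\<in>UNIV. A $ u $ v * y $ v)"
    using arg_cong[OF y(1), of "\<lambda>x. x $ u"] by (simp add: matrix_vector_mult_def)
  also have "\<dots> = (\<Sum>v\<in>UNIV. if v = w then A $ u $ w * y $ w else 0)"
  proof (intro sum.cong refl)
    fix v
    show "A $ u $ v * y $ v = (if v = w then A $ u $ w * y $ w else 0)"
    proof (cases "v = w \<or> v \<in> B \<or> v \<notin> U")
      case False
      then have "v \<notin> {x \<in> U. E u x \<and> x \<notin> B}" unfolding u(2) by simp
      then have "\<not> E u v" "u \<noteq> v" using False u(1) by auto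
      then have "A $ u $ v = 0" using symmetric_matrices_of_nonzero_iff[OF A] by blast
      then show ?thesis using False by simp
    qed (use y u in auto)
  qed
  also have "\<dots> = A $ u $ w * y $ w" by simp
  finally have "A $ u $ w * y $ w = 0" by simp
  moreover have "w \<in> {x \<in> U. E u x \<and> x \<notin> B}" unfolding u(2) by simp
  then have "A $ u $ w \<noteq> 0"
    using u(1) symmetric_matrices_of_nonzero_iff[OF A, of u w] by blast
  ultimately show ?thesis using u y by simp
qed

lemma ccr_rtranclp_vanishing:
  fixes A :: "real^'v::finite^'v"
  assumes "(ccr E U)\<^sup>*\<^sup>* B B'" "A \<in> symmetric_matrices_of E"
    and "A *v y = 0" "\<forall>v\<in>B. y $ v = 0" "\<forall>v. v \<notin> U \<longrightarrow> y $ v = 0"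
  shows "\<forall>v\<in>B'. y $ v = 0"
  using assms(1)
proof (induction rule: rtranclp_induct)
  case base
  show ?case by (rule assms(4))
next
  case (step B' B'')
  show ?case by (rule ccr_vanishing[OF assms(2) step(2) assms(3) step.IH assms(5)])
qed

lemma ccr_rtranclp_subset:
  assumes "(ccr E U)\<^sup>*\<^sup>* B B'" "B \<subseteq> U"
  shows "B' \<subseteq> U"
  using assms(1)
proof (induction rule: rtranclp_induct)
  case (step B' B'')
  then obtain u w where "{x \<in> U. E u x \<and> x \<notin> B'} = {w}" "B'' = insert w B'"
    unfolding ccr_def by blast
  then show ?case using step.IH by blast
qed (rule assms(2))

section \<open>Components of induced subgraphs and the answers of the oracle\<close>

lemma induced_components_subset: "W \<in> induced_components E U \<Longrightarrow> W \<subseteq> U"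
proof
  let ?r = "\<lambda>a b. a \<in> U \<and> b \<in> U \<and> E a b"
  fix y assume "W \<in> induced_components E U" "y \<in> W"
  then obtain x where "x \<in> U" "?r\<^sup>*\<^sup>* x y" unfolding induced_components_def by blast
  show "y \<in> U" using \<open>?r\<^sup>*\<^sup>* x y\<close> by (cases rule: rtranclp.cases) (use \<open>x \<in> U\<close> in auto)
qed

lemma induced_components_cover: "v \<in> U \<Longrightarrow> \<exists>W\<in>induced_components E U. v \<in> W"
  unfolding induced_components_def by blast

lemma induced_components_separate:
  assumes E: "\<And>a b. E a b \<Longrightarrow> E b a"
    and W: "W \<in> induced_components E U" "W' \<in> induced_components E U" "W \<noteq> W'"
    and ab: "a \<in> W" "b \<in> W'"
  shows "a \<noteq> b \<and> \<not> E a b"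
proof (rule ccontr)
  let ?r = "\<lambda>a b. a \<in> U \<and> b \<in> U \<and> E a b"
  assume "\<not> (a \<noteq> b \<and> \<not> E a b)"
  then have "?r\<^sup>*\<^sup>* a b"
    using ab W(1,2) induced_components_subset by blast
  have sym: "?r\<^sup>*\<^sup>* y x" if "?r\<^sup>*\<^sup>* x y" for x y
    using that by (induction rule: rtranclp_induct) (use E in \<open>auto intro: converse_rtranclp_into_rtranclp\<close>)
  have eq: "V = {y. ?r\<^sup>*\<^sup>* a y}" if "V \<in> induced_components E U" "a \<in> V" for V a
  proof -
    obtain x where x: "V = {y. ?r\<^sup>*\<^sup>* x y}" using \<open>V \<in> _\<close> unfolding induced_components_def by blast
    then have "?r\<^sup>*\<^sup>* x a" using that by blast
    then show ?thesis using x sym rtranclp_trans[of ?r] by blast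
  qed
  have "W = {y. ?r\<^sup>*\<^sup>* a y}" "W' = {y. ?r\<^sup>*\<^sup>* b y}" using eq W ab by blast+
  then have "W = W'" using \<open>?r\<^sup>*\<^sup>* a b\<close> sym rtranclp_trans[of ?r] by blast
  then show False using W by blast
qed

text \<open>
  Restrictions of a kernel vector to components of \<open>G[V - B]\<close> are mutually orthogonal and
  isotropic for \<open>A\<close>, so among \<open>q + 1\<close> of them some combination lies in the kernel again.
  Its support is the oracle's answer under which \<open>x\<close> survives the forcing.
\<close>

lemma zero_kernel_oracle:
  fixes A :: "real^'v::finite^'v"
  assumes A: "A \<in> symmetric_matrices_of E" and q: "num_neg_eigenvalues A < card \<W>"
    and W: "\<W> \<subseteq> induced_components E (UNIV - B)" and x: "x \<in> zero_kernel A B"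
  obtains R where "R \<subseteq> \<W>" "R \<noteq> {}"
    "\<And>B'. (ccr E (B \<union> \<Union>R))\<^sup>*\<^sup>* B B' \<Longrightarrow> x \<in> zero_kernel A B'"
proof -
  have tA: "transpose A = A" using A by (simp add: symmetric_matrices_of_def)
  have sep: "a \<noteq> b \<and> A $ a $ b = 0"
    if "V \<in> induced_components E (UNIV - B)" "V' \<in> induced_components E (UNIV - B)" "V \<noteq> V'"
      "a \<in> V" "b \<in> V'" for V V' a b
    using induced_components_separate[OF _ that] symmetric_matrices_of_sym[OF A]
      symmetric_matrices_of_nonzero_iff[OF A] by metis
  have Ax: "A *v x = 0" and xB: "\<And>v. v \<in> B \<Longrightarrow> x $ v = 0"
    using x by (auto simp: zero_kernel_def)
  define f :: "'v set \<Rightarrow> real^'v" where "f W = (\<chi> v. if v \<in> W then x $ v else 0)" for W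
  obtain c where c: "\<exists>W\<in>\<W>. c W \<noteq> 0"
    "(\<Sum>W\<in>\<W>. c W *\<^sub>R f W) \<bullet> (A *v (\<Sum>W\<in>\<W>. c W *\<^sub>R f W)) = 0 \<Longrightarrow>
     A *v (\<Sum>W\<in>\<W>. c W *\<^sub>R f W) = 0"
    using nonneg_combination_of_many_vectors[OF tA finite q, of f] by blast
  define y where "y = (\<Sum>W\<in>\<W>. c W *\<^sub>R f W)"
  have y_sum: "y $ v = (\<Sum>W\<in>\<W>. c W * (if v \<in> W then x $ v else 0))" for v
    by (simp add: y_def f_def)
  have y_in: "y $ v = c W * x $ v" if "W \<in> \<W>" "v \<in> W" for v W
  proof -
    have eq: "W' = W" if "W' \<in> \<W>" "v \<in> W'" for W'
      using sep[of W' W v v] that \<open>W \<in> \<W>\<close> \<open>v \<in> W\<close> W by blast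
    have "y $ v = (\<Sum>W'\<in>\<W>. if W' = W then c W * x $ v else 0)"
      unfolding y_sum using that by (intro sum.cong refl) (auto dest: eq)
    then show ?thesis using that by simp
  qed
  have y_out: "y $ v = 0" if "v \<notin> \<Union>\<W> \<or> x $ v = 0" for v
    unfolding y_sum using that by (intro sum.neutral) auto
  \<comment> \<open>The neighbours of \<open>v\<close> lie in \<open>W\<close>, where
    \<open>y\<close> is \<open>c W\<close> times \<open>x\<close>, or in \<open>B\<close>, where
    both vanish. So row \<open>v\<close> is a multiple of the same row of
    \<open>A *v x = 0\<close>.\<close>
  have Ay_in: "(A *v y) $ v = 0" if v: "W \<in> \<W>" "v \<in> W" for v W
  proof -
    have eq: "A $ v $ w * y $ w = c W * (A $ v $ w * x $ w)" for w
    proof (cases "w \<in> W \<or> w \<in> B")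
      case True
      then show ?thesis using y_in v y_out xB by auto
    next
      case False
      then obtain V where "V \<in> induced_components E (UNIV - B)" "w \<in> V"
        using induced_components_cover[of w "UNIV - B" E] by auto
      then have "A $ v $ w = 0" using sep False v W by blast
      then show ?thesis by simp
    qed
    have "(A *v y) $ v = c W * (A *v x) $ v"
      unfolding matrix_vector_mult_def vec_lambda_beta eq by (simp add: sum_distrib_left)
    then show ?thesis using Ax by simp
  qed
  have "y $ v * (A *v y) $ v = 0" for v
  proof (cases "v \<in> \<Union>\<W>")
    case True
    then show ?thesis using Ay_in by (metis UnionE mult_zero_right)
  next
    case False
    then have "y $ v = 0" using y_out by blast
    then show ?thesis by simp
  qed
  then have "y \<bullet> (A *v y) = 0" unfolding inner_vec_def by (intro sum.neutral) simp
  then have Ay: "A *v y = 0" by (rule c(2)[folded y_def])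
  define R where "R = {W \<in> \<W>. c W \<noteq> 0}"
  show thesis
  proof (rule that[of R])
    show "R \<subseteq> \<W>" "R \<noteq> {}" using c(1) by (auto simp: R_def)
    fix B' assume B': "(ccr E (B \<union> \<Union>R))\<^sup>*\<^sup>* B B'"
    have "\<forall>v. v \<notin> B \<union> \<Union>R \<longrightarrow> y $ v = 0"
    proof (intro allI impI)
      fix v assume "v \<notin> B \<union> \<Union>R"
      then consider "v \<notin> \<Union>\<W>" | W where "W \<in> \<W>" "v \<in> W" "c W = 0"
        by (auto simp: R_def)
      then show "y $ v = 0"
      proof cases
        case 1
        then show ?thesis using y_out by blast
      next
        case (2 W)
        then show ?thesis using y_in[of W v] by simp
      qed
    qed
    then have y0: "\<forall>v\<in>B'. y $ v = 0"
      using ccr_rtranclp_vanishing[OF B' A Ay] y_out xB by blast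
    have "B' \<subseteq> B \<union> \<Union>R" using ccr_rtranclp_subset[OF B'] by blast
    \<comment> \<open>On a component in the answer \<open>R\<close> the factor \<open>c W\<close> is
      nonzero, so \<open>x\<close> vanishes wherever \<open>y\<close> does.\<close>
    have "x $ v = 0" if v: "v \<in> B'" for v
    proof (cases "v \<in> B")
      case False
      then obtain W where "W \<in> \<W>" "v \<in> W" "c W \<noteq> 0"
        using v \<open>B' \<subseteq> B \<union> \<Union>R\<close> by (auto simp: R_def)
      moreover have "y $ v = 0" using y0 v by blast
      ultimately show ?thesis using y_in[of W v] by simp
    qed (rule xB)
    then show "x \<in> zero_kernel A B'" using Ax by (simp add: zero_kernel_def)
  qed
qed

lemma Zq_win_dim_zero_kernel:
  fixes A :: "real^'v::finite^'v"
  assumes "Zq_win q E m B" and A: "A \<in> S_q q E"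
  shows "dim (zero_kernel A B) \<le> m"
  using assms(1)
proof (induction rule: Zq_win.induct)
  case (finished m)
  have "zero_kernel A UNIV \<subseteq> {0}" by (auto simp: zero_kernel_def vec_eq_iff)
  then show ?case by (metis dim_le_card' card.empty dim_eq_0 le0)
next
  case (token v B m)
  have "zero_kernel A (insert v B) = zero_kernel A B \<inter> {x. \<forall>f\<in>{axis v 1}. f \<bullet> x = 0}"
    by (auto simp: zero_kernel_def inner_axis')
  then have "dim (zero_kernel A B) \<le> dim (zero_kernel A (insert v B)) + card {axis v (1::real)}"
    using dim_Int_hyperplanes[OF subspace_zero_kernel, of "{axis v 1}" A B] by simp
  then show ?case using token by simp
next
  case (force B B' m)
  have "zero_kernel A B \<subseteq> zero_kernel A B'"
    using ccr_vanishing[OF _ force(1)] A by (auto simp: zero_kernel_def S_q_def)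
  then have "dim (zero_kernel A B) \<le> dim (zero_kernel A B')" by (rule dim_subset)
  then show ?case using force by simp
next
  case (select \<W> B m)
  let ?\<R> = "{R. R \<subseteq> \<W> \<and> R \<noteq> {}}"
  \<comment> \<open>\<open>g R\<close> is the coloured set that the strategy reaches after the
    answer \<open>R\<close>.\<close>
  obtain g where g: "\<And>R. R \<in> ?\<R> \<Longrightarrow> (ccr E (B \<union> \<Union>R))\<^sup>*\<^sup>* B (g R)"
    "\<And>R. R \<in> ?\<R> \<Longrightarrow> dim (zero_kernel A (g R)) \<le> m"
  proof -
    have "\<forall>R. \<exists>B'. R \<in> ?\<R> \<longrightarrow> (ccr E (B \<union> \<Union>R))\<^sup>*\<^sup>* B B' \<and> dim (zero_kernel A B') \<le> m"
      using select(3) by blast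
    from choice[OF this] show thesis using that by blast
  qed
  have "zero_kernel A B \<subseteq> \<Union>((\<lambda>R. zero_kernel A (g R)) ` ?\<R>)"
  proof
    fix x assume x: "x \<in> zero_kernel A B"
    have "num_neg_eigenvalues A < card \<W>" "A \<in> symmetric_matrices_of E"
      using A select(2) by (auto simp: S_q_def)
    then obtain R where "R \<subseteq> \<W>" "R \<noteq> {}"
      "\<And>B'. (ccr E (B \<union> \<Union>R))\<^sup>*\<^sup>* B B' \<Longrightarrow> x \<in> zero_kernel A B'"
      using zero_kernel_oracle[OF _ _ select(1) x] by metis
    then show "x \<in> \<Union>((\<lambda>R. zero_kernel A (g R)) ` ?\<R>)" using g(1) by blast
  qed
  then have "\<exists>S\<in>(\<lambda>R. zero_kernel A (g R)) ` ?\<R>. zero_kernel A B \<subseteq> S"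
    by (intro subspace_subset_Union) (auto simp: subspace_zero_kernel)
  then obtain R where "R \<in> ?\<R>" "zero_kernel A B \<subseteq> zero_kernel A (g R)" by blast
  then show ?case using g(2) dim_subset order_trans by metis
qed

text \<open>The given win ensures that the \<open>LEAST\<close> in \<open>Z_q\<close> is
  attained.\<close>

lemma nullity_le_Z_q:
  fixes E :: "'v::finite \<Rightarrow> 'v \<Rightarrow> bool"
  assumes "Zq_win q E m {}" "A \<in> S_q q E"
  shows "nullity A \<le> Z_q q E"
proof -
  have "Zq_win q E (Z_q q E) {}" unfolding Z_q_def using assms(1) by (rule LeastI)
  from Zq_win_dim_zero_kernel[OF this assms(2)] show ?thesis
    by (simp add: zero_kernel_def nullity_def)
qed

section \<open>Threshold graphs\<close>

text \<open>The tags make the list lexicographically sorted, so that comparing positions becomes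
  comparing blocks.\<close>

definition block_labels :: "nat \<Rightarrow> (nat \<Rightarrow> nat) \<Rightarrow> (nat \<Rightarrow> nat) \<Rightarrow> (nat \<times> bool) list" where
  "block_labels s k t =
     concat (map (\<lambda>i. replicate (k i) (i, False) @ replicate (t i) (i, True)) [1..<Suc s])"

lemma map_snd_block_labels: "map snd (block_labels s k t) = block_sequence s k t"
  by (simp add: block_labels_def block_sequence_def map_concat comp_def del: upt_Suc)

lemma block_labels_Suc:
  "block_labels (Suc s) k t =
     block_labels s k t @ replicate (k (Suc s)) (Suc s, False) @ replicate (t (Suc s)) (Suc s, True)"
  by (simp add: block_labels_def)

lemma fst_block_labels: "p \<in> set (block_labels s k t) \<Longrightarrow> fst p \<in> {1..s}"
  by (auto simp: block_labels_def simp del: upt_Suc)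

lemma sorted_block_labels:
  "sorted_wrt (\<lambda>p p'. fst p < fst p' \<or> fst p = fst p' \<and> snd p \<le> snd p') (block_labels s k t)"
  (is "sorted_wrt ?R _")
proof (induction s)
  case 0
  show ?case by (simp add: block_labels_def)
next
  case (Suc s)
  have less: "fst p < Suc s" if "p \<in> set (block_labels s k t)" for p
    using fst_block_labels[OF that] by simp
  have "sorted_wrt ?R (replicate m x)" for m x
    by (induction m) auto
  then show ?case using Suc
    by (auto simp: block_labels_Suc sorted_wrt_append dest: less)
qed

lemma length_filter_block_labels:
  assumes "i \<in> {1..s}"
  shows "length (filter ((=) (i, c)) (block_labels s k t)) = (if c then t i else k i)"
  using assms
proof (induction s)
  case (Suc s)
  show ?case
  proof (cases "i = Suc s")
    case True
    have "filter ((=) (i, c)) (block_labels s k t) = []"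
      using True fst_block_labels[of _ s k t] by (force simp: filter_empty_conv)
    then show ?thesis using True by (simp add: block_labels_Suc)
  next
    case False
    then show ?thesis using Suc by (auto simp: block_labels_Suc)
  qed
qed simp

text \<open>
  \<open>blk v\<close> is the index \<open>i\<close> of the pair of runs (\<open>k i\<close> zeros, \<open>t i\<close> ones) containing the entry of
  \<open>v\<close> in the creation sequence, and \<open>one v\<close> tells whether this entry is 1.
\<close>

locale threshold_blocks =
  fixes E :: "'v::finite \<Rightarrow> 'v \<Rightarrow> bool" and blk :: "'v \<Rightarrow> nat" and one :: "'v \<Rightarrow> bool"
    and s :: nat and k t :: "nat \<Rightarrow> nat"
  assumes irrefl: "\<not> E v v"
    and adjacent: "u \<noteq> v \<Longrightarrow> E u v \<longleftrightarrow> one u \<and> one v \<or> one u \<and> \<not> one v \<and> blk v \<le> blk u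
                                 \<or> \<not> one u \<and> one v \<and> blk u \<le> blk v"
    and blk_range: "blk v \<in> {1..s}"
    and card_zeros: "i \<in> {1..s} \<Longrightarrow> card {v. \<not> one v \<and> blk v = i} = k i"
    and card_ones: "i \<in> {1..s} \<Longrightarrow> card {v. one v \<and> blk v = i} = t i"
    and k_pos: "i \<in> {1..s} \<Longrightarrow> 1 \<le> k i"
    and t_pos: "i \<in> {1..s} \<Longrightarrow> 1 \<le> t i"

lemma creation_sequence_blocks:
  fixes E :: "'v::finite \<Rightarrow> 'v \<Rightarrow> bool"
  assumes E: "has_creation_sequence E (block_sequence s k t)"
    and pos: "\<forall>i\<in>{1..s}. k i \<ge> 1 \<and> t i \<ge> 1"
  obtains blk one where "threshold_blocks E blk one s k t"
proof -
  let ?l = "block_labels s k t"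
  have len: "length (block_sequence s k t) = length ?l"
    using map_snd_block_labels by (metis length_map)
  have nth: "block_sequence s k t ! j \<longleftrightarrow> snd (?l ! j)" if "j < length ?l" for j
    using that by (metis map_snd_block_labels nth_map)
  obtain v where v: "bij_betw v {..<length ?l} UNIV"
    and adj: "\<And>i j. i < j \<Longrightarrow> j < length ?l \<Longrightarrow> E (v i) (v j) \<longleftrightarrow> snd (?l ! j)"
    using E nth len unfolding has_creation_sequence_def by metis
  have simple: "\<And>a b. E a b \<longleftrightarrow> E b a" "\<And>a. \<not> E a a"
    using E unfolding has_creation_sequence_def simple_graph_def
    by (auto simp: irreflp_def dest: sympD)
  define w where "w = the_inv_into {..<length ?l} v"
  have w: "v (w u) = u" "w u < length ?l" for u
    using f_the_inv_into_f_bij_betw[OF v, of u] the_inv_into_into[OF bij_betw_imp_inj_on[OF v], of u] v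
    by (auto simp: w_def bij_betw_def)
  have wv: "w (v i) = i" if "i < length ?l" for i
    using the_inv_into_f_f[OF bij_betw_imp_inj_on[OF v]] that by (simp add: w_def)
  define blk where "blk u = fst (?l ! w u)" for u
  define one where "one u = snd (?l ! w u)" for u
  have sorted: "blk a < blk b \<or> blk a = blk b \<and> one a \<le> one b" if "w a < w b" for a b
    using sorted_wrt_nth_less[OF sorted_block_labels that] w by (simp add: blk_def one_def)
  \<comment> \<open>The later vertex decides. This agrees with the position-free formula because, by
    \<open>sorted\<close>, a 1-vertex followed by a 0-vertex lies in a strictly lower block.\<close>
  have less: "E a b \<longleftrightarrow> one a \<and> one b \<or> one a \<and> \<not> one b \<and> blk b \<le> blk a
      \<or> \<not> one a \<and> one b \<and> blk a \<le> blk b" if "w a < w b" for a b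
  proof -
    have "E a b \<longleftrightarrow> one b" using adj[OF that] w by (simp add: one_def)
    then show ?thesis using sorted[OF that] by auto
  qed
  have count: "card {u. one u = c \<and> blk u = i} = (if c then t i else k i)" if "i \<in> {1..s}" for c i
  proof -
    have "{u. one u = c \<and> blk u = i} = v ` {j. j < length ?l \<and> (i, c) = ?l ! j}"
    proof (intro equalityI subsetI)
      fix u assume "u \<in> {u. one u = c \<and> blk u = i}"
      then have "(i, c) = ?l ! w u" by (cases "?l ! w u") (auto simp: blk_def one_def)
      then show "u \<in> v ` {j. j < length ?l \<and> (i, c) = ?l ! j}"
        using w[of u] by (intro image_eqI[of u v "w u"]) auto
    next
      fix u assume "u \<in> v ` {j. j < length ?l \<and> (i, c) = ?l ! j}"
      then obtain j where "j < length ?l" "(i, c) = ?l ! j" "u = v j" by blast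
      then show "u \<in> {u. one u = c \<and> blk u = i}"
        using wv[of j] by (simp add: one_def blk_def flip: \<open>(i, c) = ?l ! j\<close>)
    qed
    moreover have "inj_on v {j. j < length ?l \<and> (i, c) = ?l ! j}"
      using bij_betw_imp_inj_on[OF v] by (rule inj_on_subset) auto
    ultimately have "card {u. one u = c \<and> blk u = i} = card {j. j < length ?l \<and> (i, c) = ?l ! j}"
      by (simp add: card_image)
    then show ?thesis
      using length_filter_block_labels[OF that, of c k t] by (simp add: length_filter_conv_card)
  qed
  have "threshold_blocks E blk one s k t"
  proof
    fix a b :: 'v
    assume "a \<noteq> b"
    then have "w a \<noteq> w b" using w(1) by metis
    then consider "w a < w b" | "w b < w a" by linarith
    then show "E a b \<longleftrightarrow> one a \<and> one b \<or> one a \<and> \<not> one b \<and> blk b \<le> blk a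
      \<or> \<not> one a \<and> one b \<and> blk a \<le> blk b"
    proof cases
      case 2
      then show ?thesis using less[OF 2] simple(1)[of a b] by blast
    qed (rule less)
  next
    show "blk u \<in> {1..s}" for u unfolding blk_def by (rule fst_block_labels[of _ s k t]) (intro nth_mem w)
    show "card {v. \<not> one v \<and> blk v = i} = k i" if "i \<in> {1..s}" for i
      using count[OF that, of False] by simp
    show "card {v. one v \<and> blk v = i} = t i" if "i \<in> {1..s}" for i
      using count[OF that, of True] by simp
  qed (use simple pos in auto)
  then show thesis by (rule that)
qed

section \<open>The strategy of the player\<close>

lemma Zq_win_mono: "Zq_win q E m B \<Longrightarrow> m \<le> m' \<Longrightarrow> Zq_win q E m' B"
proof (induction arbitrary: m' rule: Zq_win.induct)
  case (finished m)
  show ?case by (rule Zq_win.finished)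
next
  case (token v B m)
  then obtain m'' where "m' = Suc m''" "m \<le> m''" by (metis Suc_le_D Suc_le_mono)
  then show ?case using token Zq_win.token by metis
next
  case (force B B' m)
  then show ?case using Zq_win.force by metis
next
  case (select \<W> B m)
  then show ?case by (intro Zq_win.select[of \<W>]) blast+
qed

lemma Zq_win_tokens:
  assumes "finite X" "Zq_win q E m (B \<union> X)"
  shows "Zq_win q E (m + card X) B"
  using assms
proof (induction X arbitrary: B rule: finite_induct)
  case (insert x X)
  show ?case
  proof (cases "x \<in> B")
    case True
    then have "Zq_win q E (m + card X) B" using insert by (simp add: insert_absorb)
    then show ?thesis by (rule Zq_win_mono) (use insert in simp)
  next
    case False
    have "Zq_win q E (m + card X) (insert x B)" using insert by simp
    then show ?thesis using Zq_win.token[OF False] insert by simp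
  qed
qed simp

lemma Zq_win_forces:
  assumes "(ccr E UNIV)\<^sup>*\<^sup>* B B'" "Zq_win q E m B'"
  shows "Zq_win q E m B"
  using assms by (induction rule: converse_rtranclp_induct) (auto intro: Zq_win.force)

context threshold_blocks
begin

lemma ex_one: "i \<in> {1..s} \<Longrightarrow> \<exists>v. one v \<and> blk v = i"
  using card_ones t_pos by (metis (mono_tags, lifting) card.empty empty_Collect_eq not_one_le_zero)

lemma ex_zero: "i \<in> {1..s} \<Longrightarrow> \<exists>v. \<not> one v \<and> blk v = i"
  using card_zeros k_pos by (metis (mono_tags, lifting) card.empty empty_Collect_eq not_one_le_zero)

text \<open>
  A 1-vertex of the lowest block met by \<open>U - B\<close> has exactly one uncoloured neighbour.
\<close>

lemma ccr_zeros:
  assumes "{v. one v} \<subseteq> B" "B \<subseteq> U" "inj_on blk (U - B)"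
  shows "(ccr E U)\<^sup>*\<^sup>* B U"
  using assms
proof (induction "card (U - B)" arbitrary: B rule: less_induct)
  case less
  show ?case
  proof (cases "U = B")
    case False
    then have "blk ` (U - B) \<noteq> {}" using less.prems by blast
    then have "Min (blk ` (U - B)) \<in> blk ` (U - B)" by (intro Min_in) auto
    then obtain w where w: "w \<in> U - B" "blk w = Min (blk ` (U - B))" by (metis imageE)
    have minimal: "blk w \<le> blk x" if "x \<in> U - B" for x
      unfolding w(2) using that by (intro Min_le) auto
    obtain p where p: "one p" "blk p = blk w" using ex_one blk_range by blast
    \<comment> \<open>An uncoloured neighbour of \<open>p\<close> is a 0-vertex of a block not above
      that of \<open>w\<close>, hence of the same block by minimality, hence \<open>w\<close> by
      injectivity.\<close>
    have "{x \<in> U. E p x \<and> x \<notin> B} = {w}"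
    proof safe
      fix x assume x: "x \<in> U" "E p x" "x \<notin> B"
      then have "\<not> one x" "x \<noteq> p" using less.prems p by auto
      then have "blk x \<le> blk w" using adjacent[of p x] x p by auto
      then have "blk x = blk w" using minimal[of x] x by simp
      then show "x = w" using less.prems(3) x w(1) by (auto dest: inj_onD)
    next
      have "\<not> one w" "w \<noteq> p" using less.prems p w by auto
      then show "E p w" using adjacent[of p w] p by auto
    qed (use w in auto)
    then have "ccr E U B (insert w B)"
      unfolding ccr_def using p less.prems by blast
    moreover have "(ccr E U)\<^sup>*\<^sup>* (insert w B) U"
    proof (rule less.hyps)
      have "U - insert w B \<subset> U - B" using w by blast
      then show "card (U - insert w B) < card (U - B)" by (intro psubset_card_mono) auto
      show "inj_on blk (U - insert w B)" using less.prems(3) by (rule inj_on_subset) blast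
    qed (use less.prems w in auto)
    ultimately show ?thesis by (rule converse_rtranclp_into_rtranclp)
  qed simp
qed

lemma singleton_component:
  assumes "{v. one v} \<subseteq> B" "x \<notin> B"
  shows "{x} \<in> induced_components E (UNIV - B)"
proof -
  have "y = x" if "(\<lambda>a b. a \<in> UNIV - B \<and> b \<in> UNIV - B \<and> E a b)\<^sup>*\<^sup>* x y" for y
    using that
  proof (cases rule: converse_rtranclpE)
    case (step z)
    then have "\<not> one x" "\<not> one z" "E x z" using assms by auto
    then show ?thesis using adjacent irrefl by metis
  qed simp
  then have "{x} = {y. (\<lambda>a b. a \<in> UNIV - B \<and> b \<in> UNIV - B \<and> E a b)\<^sup>*\<^sup>* x y}" by auto
  then show ?thesis using assms(2) unfolding induced_components_def by blast
qed

text \<open>The term \<open>+ 1\<close> is the vertex of each block that is left to be forced and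
  costs no token. \<open>M\<close> bounds the sums over at most \<open>q\<close> blocks because
  fewer than \<open>q\<close> may be unfinished when the tokens are spent.\<close>

lemma Zq_win_ones_coloured:
  assumes "{v. one v} \<subseteq> B" "\<And>i. i \<in> {1..s} \<Longrightarrow> card {v. v \<notin> B \<and> blk v = i} \<le> a i + 1"
    and M: "\<And>J. J \<subseteq> {1..s} \<Longrightarrow> card J \<le> q \<Longrightarrow> sum a J \<le> M"
  shows "Zq_win q E M B"
  using assms(1,2)
proof (induction "card (- B)" arbitrary: B rule: less_induct)
  case less
  \<comment> \<open>\<open>P\<close> is the set of unfinished blocks, and \<open>h i\<close> an
    uncoloured vertex of block \<open>i\<close>.\<close>
  define P where "P = blk ` (- B)"
  define h where "h = inv_into (- B) blk"
  have h: "h i \<notin> B" "blk (h i) = i" if "i \<in> P" for i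
    using that inv_into_into[of i blk "- B"] f_inv_into_f[of i blk "- B"] by (auto simp: h_def P_def)
  have P: "P \<subseteq> {1..s}" "finite P" using blk_range by (auto simp: P_def)
  show ?case
  proof (cases "card P \<le> q")
    case True
    define X where "X = - B - h ` P"
    have "inj_on blk (UNIV - (B \<union> X))"
      using h by (intro inj_onI) (auto simp: X_def)
    then have "(ccr E UNIV)\<^sup>*\<^sup>* (B \<union> X) UNIV"
      using less.prems by (intro ccr_zeros) auto
    then have "Zq_win q E 0 (B \<union> X)" by (rule Zq_win_forces) (rule Zq_win.finished)
    then have "Zq_win q E (0 + card X) B" by (intro Zq_win_tokens) auto
    moreover have "card X \<le> M"
    proof -
      have "X \<subseteq> (\<Union>i\<in>P. {v. v \<notin> B \<and> blk v = i} - {h i})"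
        by (auto simp: X_def P_def)
      then have "card X \<le> card (\<Union>i\<in>P. {v. v \<notin> B \<and> blk v = i} - {h i})"
        by (intro card_mono) auto
      also have "\<dots> \<le> (\<Sum>i\<in>P. card ({v. v \<notin> B \<and> blk v = i} - {h i}))"
        using P by (intro card_UN_le) auto
      also have "\<dots> \<le> sum a P"
      proof (rule sum_mono)
        fix i assume i: "i \<in> P"
        then have "card ({v. v \<notin> B \<and> blk v = i} - {h i}) = card {v. v \<notin> B \<and> blk v = i} - 1"
          using h by (intro card_Diff_singleton) auto
        then show "card ({v. v \<notin> B \<and> blk v = i} - {h i}) \<le> a i"
          using less.prems(2)[of i] i P by auto
      qed
      also have "\<dots> \<le> M" using M P True by blast
      finally show ?thesis .
    qed
    ultimately show ?thesis by (auto intro: Zq_win_mono)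
  next
    case False
    let ?W = "(\<lambda>i. {h i}) ` P"
    have "inj_on (\<lambda>i. {h i}) P" using h(2) by (auto intro!: inj_onI) metis
    then have "card ?W = card P" by (rule card_image)
    moreover have "?W \<subseteq> induced_components E (UNIV - B)"
      using singleton_component[OF less.prems(1)] h(1) by blast
    \<comment> \<open>Whatever the answer, it consists of isolated vertices from distinct blocks, so
      \<open>ccr_zeros\<close> colours all of it and the number of uncoloured vertices
      drops.\<close>
    moreover have "\<exists>B'. (ccr E (B \<union> \<Union>R))\<^sup>*\<^sup>* B B' \<and> Zq_win q E M B'"
      if R: "R \<subseteq> ?W" "R \<noteq> {}" for R
    proof (intro exI conjI)
      have "\<Union>R \<subseteq> h ` P" using R by auto
      moreover have "inj_on blk (h ` P)" by (rule inj_onI) (use h(2) in force)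
      ultimately have "inj_on blk (B \<union> \<Union>R - B)" using inj_on_subset[of blk "h ` P" "B \<union> \<Union>R - B"] by blast
      then show "(ccr E (B \<union> \<Union>R))\<^sup>*\<^sup>* B (B \<union> \<Union>R)"
        using less.prems(1) by (intro ccr_zeros) auto
      obtain i where "i \<in> P" "h i \<in> \<Union>R" using R by blast
      then have "- (B \<union> \<Union>R) \<subset> - B" using h(1) by blast
      then have "card (- (B \<union> \<Union>R)) < card (- B)" by (intro psubset_card_mono) auto
      then show "Zq_win q E M (B \<union> \<Union>R)"
      proof (rule less.hyps)
        fix i assume i: "i \<in> {1..s}"
        have "card {v. v \<notin> B \<union> \<Union>R \<and> blk v = i} \<le> card {v. v \<notin> B \<and> blk v = i}"
          by (intro card_mono) auto
        then show "card {v. v \<notin> B \<union> \<Union>R \<and> blk v = i} \<le> a i + 1"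
          using less.prems(2)[OF i] by linarith
      qed (use less.prems in auto)
    qed
    ultimately show ?thesis using False by (intro Zq_win.select[of ?W]) auto
  qed
qed

lemma card_all_ones: "card {v. one v} = (\<Sum>i=1..s. t i)"
proof -
  have "{v. one v} = (\<Union>i\<in>{1..s}. {v. one v \<and> blk v = i})" using blk_range by auto
  then have "card {v. one v} = (\<Sum>i\<in>{1..s}. card {v. one v \<and> blk v = i})"
    by (simp only:) (intro card_UN_disjoint, auto)
  then show ?thesis using card_ones by simp
qed

text \<open>
  Instead of all 1-vertices the player buys, in each block, all but one of them and one 0-vertex;
  from the last block downwards this 0-vertex forces the omitted 1-vertex.
\<close>

lemma Zq_win_empty:
  assumes a: "\<And>i. i \<in> {1..s} \<Longrightarrow> k i \<le> a i + 2"
    and M: "\<And>J. J \<subseteq> {1..s} \<Longrightarrow> card J \<le> q \<Longrightarrow> sum a J \<le> M"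
  shows "Zq_win q E ((\<Sum>i=1..s. t i) + M) {}"
proof -
  obtain p where p: "\<And>i. i \<in> {1..s} \<Longrightarrow> one (p i)" "\<And>i. i \<in> {1..s} \<Longrightarrow> blk (p i) = i"
    using ex_one by metis
  obtain z where z: "\<And>i. i \<in> {1..s} \<Longrightarrow> \<not> one (z i)" "\<And>i. i \<in> {1..s} \<Longrightarrow> blk (z i) = i"
    using ex_zero by metis
  define X where "X = ({v. one v} - p ` {1..s}) \<union> z ` {1..s}"
  have "inj_on p {1..s}" by (rule inj_onI) (metis p(2))
  then have p_card: "card (p ` {1..s}) = s" by (simp add: card_image)
  have "card X \<le> card ({v. one v} - p ` {1..s}) + card (z ` {1..s})"
    unfolding X_def by (rule card_Un_le)
  moreover have "card ({v. one v} - p ` {1..s}) = card {v. one v} - s"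
    using p p_card by (subst card_Diff_subset) auto
  moreover have "card (z ` {1..s}) \<le> s" using card_image_le[of "{1..s}" z] by simp
  \<comment> \<open>This makes the truncated \<open>card {v. one v} - s\<close> a true
    difference.\<close>
  moreover have "s \<le> card {v. one v}"
  proof -
    have "card (p ` {1..s}) \<le> card {v. one v}" using p by (intro card_mono) auto
    then show ?thesis using p_card by simp
  qed
  ultimately have card_X: "card X \<le> (\<Sum>i=1..s. t i)" using card_all_ones by linarith
  \<comment> \<open>Downward induction: the omitted 1-vertices of all blocks above \<open>i\<close>
    have been forced.\<close>
  have "(ccr E UNIV)\<^sup>*\<^sup>* X (X \<union> p ` {i<..s})" if "i \<le> s" for i
    using that
  proof (induction rule: inc_induct)
    case base
    show ?case by simp
  next
    case (step i)
    let ?B = "X \<union> p ` {Suc i<..s}"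
    have i: "Suc i \<in> {1..s}" using step by simp
    \<comment> \<open>A neighbour of this 0-vertex is a 1-vertex of the same or a higher block;
      uncoloured, it is an omitted \<open>p j\<close>, and those with larger \<open>j\<close> are
      already coloured.\<close>
    have unique: "x = p (Suc i)" if x: "E (z (Suc i)) x" "x \<notin> ?B" for x
    proof -
      have "x \<noteq> z (Suc i)" using x(1) irrefl by metis
      then have x': "one x" "Suc i \<le> blk x"
        using adjacent[of "z (Suc i)" x] x(1) z[OF i] by auto
      then obtain j where j: "j \<in> {1..s}" "x = p j" using x(2) by (auto simp: X_def)
      then have "\<not> Suc i < j" using x(2) by auto
      then have "j = Suc i" using x'(2) j p by simp
      then show ?thesis using j by simp
    qed
    have edge: "E (z (Suc i)) (p (Suc i))"
      using adjacent[of "z (Suc i)" "p (Suc i)"] z[OF i] p[OF i] by force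
    have "p (Suc i) \<notin> ?B"
    proof
      assume "p (Suc i) \<in> ?B"
      moreover have "p (Suc i) \<notin> X" using z(1) p(1)[OF i] i
        by (auto simp: X_def)
      ultimately obtain j where j: "j \<in> {Suc i<..s}" "p (Suc i) = p j" by auto
      then have "blk (p j) = j" "blk (p (Suc i)) = Suc i" using p(2)[OF i] p(2)[of j] by auto
      then show False using j by simp
    qed
    with edge have "{x \<in> UNIV. E (z (Suc i)) x \<and> x \<notin> ?B} = {p (Suc i)}"
      by (intro equalityI subsetI) (simp_all add: unique)
    moreover have "z (Suc i) \<in> ?B \<inter> UNIV" using i by (auto simp: X_def)
    ultimately have "ccr E UNIV ?B (insert (p (Suc i)) ?B)" unfolding ccr_def by blast
    moreover have "insert (p (Suc i)) ?B = X \<union> p ` {i<..s}"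
    proof -
      have "{i<..s} = insert (Suc i) {Suc i<..s}" using step by auto
      then show ?thesis by simp
    qed
    ultimately show ?case using step.IH by (metis rtranclp.rtrancl_into_rtrancl)
  qed
  from this[of 0] have forced: "(ccr E UNIV)\<^sup>*\<^sup>* X (X \<union> p ` {0<..s})" by simp
  have "Zq_win q E M (X \<union> p ` {0<..s})"
  proof (rule Zq_win_ones_coloured[OF _ _ M])
    show "{v. one v} \<subseteq> X \<union> p ` {0<..s}" by (auto simp: X_def)
    fix i assume i: "i \<in> {1..s}"
    have "{v. v \<notin> X \<union> p ` {0<..s} \<and> blk v = i} \<subseteq> {v. \<not> one v \<and> blk v = i} - {z i}"
      using i by (auto simp: X_def)
    then have "card {v. v \<notin> X \<union> p ` {0<..s} \<and> blk v = i} \<le> card ({v. \<not> one v \<and> blk v = i} - {z i})"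
      by (intro card_mono) auto
    also have "\<dots> = k i - 1" using card_zeros[OF i] z[OF i] by (subst card_Diff_singleton) auto
    also have "\<dots> \<le> a i + 1" using a[OF i] by simp
    finally show "card {v. v \<notin> X \<union> p ` {0<..s} \<and> blk v = i} \<le> a i + 1" .
  qed
  then have "Zq_win q E M X" by (rule Zq_win_forces[OF forced])
  then have "Zq_win q E (M + card X) {}" by (intro Zq_win_tokens) auto
  then show ?thesis by (rule Zq_win_mono) (use card_X in simp)
qed

end

section \<open>A matrix attaining the bound\<close>

lemma sum_signed_powers_of_2_nonzero:
  fixes \<sigma> :: "nat \<Rightarrow> real"
  assumes "\<And>i. \<bar>\<sigma> i\<bar> = 1" "1 \<le> m"
  shows "(\<Sum>i=1..m. \<sigma> i * 2^i) \<noteq> 0"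
proof -
  \<comment> \<open>Used one index below the top: the last term outweighs all lower ones together,
    whatever the signs.\<close>
  have bound: "\<bar>\<Sum>i=1..m. \<sigma> i * 2^i\<bar> < 2^(Suc m)" for m
  proof (induction m)
    case (Suc m)
    have "\<bar>\<sigma> (Suc m) * 2^Suc m\<bar> = 2^Suc m" using assms(1) by (simp add: abs_mult)
    then show ?case using Suc by simp
  qed simp
  obtain m' where m: "m = Suc m'" using assms(2) by (cases m) auto
  have "\<bar>\<sigma> m * 2^m\<bar> = 2^m" using assms(1) by (simp add: abs_mult)
  then show ?thesis using bound[of m'] by (auto simp: m)
qed

context threshold_blocks
begin

text \<open>
  A Gram matrix for an indefinite form in which block \<open>i\<close> gets its own coordinates. If \<open>i \<notin> J\<close>,
  its 0-vertices become an orthogonal basis of a positive definite space; if \<open>i \<in> J\<close>, all of them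
  become one isotropic vector of a hyperbolic plane, or a negative vector when \<open>k i = 1\<close>.
  The 1-vertices of block \<open>j\<close> become the sum of one vector for every block \<open>i \<le> j\<close>, of norm
  \<open>\<plusminus>2^i\<close>, so that no inner product of two 1-vertices vanishes.
\<close>

lemma ex_matrix:
  assumes J: "J \<subseteq> {1..s}"
  shows "\<exists>A\<in>S_q (card J) E. (\<Sum>i=1..s. t i) + (\<Sum>i\<in>J. k i - 2) \<le> nullity A"
proof -
  have finJ: "finite J" using J finite_subset by blast
  obtain p1 where p1: "\<And>i. i \<in> {1..s} \<Longrightarrow> one (p1 i)" "\<And>i. i \<in> {1..s} \<Longrightarrow> blk (p1 i) = i"
    using ex_one by metis
  obtain z where z: "\<And>i. i \<in> {1..s} \<Longrightarrow> \<not> one (z i)" "\<And>i. i \<in> {1..s} \<Longrightarrow> blk (z i) = i"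
    using ex_zero by metis
  \<comment> \<open>\<open>o' i\<close> and \<open>\<zeta> i\<close> are the two basic linear forms
    of block \<open>i\<close>: the part of the 1-vertices of blocks from \<open>i\<close> on, and
    the 0-vertices of the block.\<close>
  define o' :: "nat \<Rightarrow> 'v \<Rightarrow> real" where "o' i v = of_bool (one v \<and> i \<le> blk v)" for i v
  define \<zeta> :: "nat \<Rightarrow> 'v \<Rightarrow> real" where "\<zeta> i v = of_bool (\<not> one v \<and> blk v = i)" for i v
  \<comment> \<open>\<open>P\<close> indexes the positive squares: one for each 0-vertex of a block
    outside \<open>J\<close>, and a single one, labelled by \<open>z i\<close>, for a block in
    \<open>J\<close> with \<open>k i \<noteq> 1\<close>.\<close>
  define P where "P = {w. \<not> one w \<and> (blk w \<notin> J \<or> w = z (blk w) \<and> k (blk w) \<noteq> 1)}"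
  \<comment> \<open>Outside \<open>J\<close> the form \<open>o' i\<close> occurs in
    \<open>k i\<close> squares; dividing by \<open>k i\<close> leaves total weight
    \<open>2^i\<close>. In a hyperbolic block the squares of \<open>\<zeta> i + o' i\<close> and
    \<open>\<zeta> i\<close> have opposite signs, so the 0-vertices become isotropic.\<close>
  define \<alpha> :: "'v \<Rightarrow> real" where "\<alpha> w = 2^blk w / (if blk w \<in> J then 1 else k (blk w))" for w
  define p :: "'v \<Rightarrow> real^'v" where
    "p w = (\<chi> v. (if blk w \<in> J then \<zeta> (blk w) v else of_bool (v = w)) + o' (blk w) v)" for w
  define n :: "nat \<Rightarrow> real^'v" where "n i = (\<chi> v. \<zeta> i v + (if k i = 1 then o' i v else 0))" for i
  \<comment> \<open>The difference of \<open>p1 i\<close> and \<open>p1 (i - 1)\<close> is dual to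
    the forms \<open>o'\<close>. Subtracting it from \<open>z i\<close> cancels
    \<open>\<zeta> i + o' i\<close> but keeps \<open>\<zeta> i\<close> at 1. Block 1 has no
    predecessor, and if \<open>k i = 1\<close> then \<open>z i\<close> alone is dual to
    \<open>n i\<close>.\<close>
  define y :: "nat \<Rightarrow> real^'v" where
    "y i = axis (z i) 1 - (if k i = 1 then 0 else axis (p1 i) 1 - (if i = 1 then 0 else axis (p1 (i - 1)) 1))" for i
  define A :: "real^'v^'v" where
    "A = (\<chi> u v. (\<Sum>w\<in>P. \<alpha> w * (p w $ u * p w $ v)) - (\<Sum>i\<in>J. 2^i * (n i $ u * n i $ v)))"

  have inner_y: "f \<bullet> y i = f $ z i - (if k i = 1 then 0 else f $ p1 i - (if i = 1 then 0 else f $ p1 (i - 1)))"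
    for f i
    by (simp add: y_def inner_diff_right inner_axis)
  have oz: "o' l (z i) = 0" "\<zeta> l (z i) = of_bool (l = i)" if "i \<in> {1..s}" for i l
    using z[OF that] by (auto simp: o'_def \<zeta>_def)
  have zp: "\<zeta> l (p1 i) = 0" if "i \<in> {1..s}" for i l
    using p1[OF that] by (auto simp: \<zeta>_def)
  have op: "o' l (p1 i) - (if i = 1 then 0 else o' l (p1 (i - 1))) = of_bool (l = i)"
    if "i \<in> {1..s}" "1 \<le> l" for i l
  proof (cases "i = 1")
    case True
    then show ?thesis using that p1[OF that(1)] by (auto simp: o'_def)
  next
    case False
    then have "i - 1 \<in> {1..s}" using that by auto
    from p1[OF this] show ?thesis using False that p1[OF that(1)] by (auto simp: o'_def)
  qed
  have zp': "\<zeta> l (p1 (i - 1)) = 0" if "i \<in> {1..s}" "i \<noteq> 1" for i l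
    using that by (intro zp) auto
  have dual_p: "p w \<bullet> y i = 0" if i: "i \<in> J" and w: "w \<in> P" for i w
  proof -
    have i': "i \<in> {1..s}" using i J by blast
    have w': "\<not> one w" "1 \<le> blk w" using w blk_range[of w] by (auto simp: P_def)
    show ?thesis
    proof (cases "blk w \<in> J")
      case True
      then have "k (blk w) \<noteq> 1" using w by (auto simp: P_def)
      then show ?thesis
        using True op[OF i' w'(2)] zp[OF i'] zp'[OF i'] oz[OF i'] by (auto simp: inner_y p_def split: if_splits)
    next
      case False
      then have "blk w \<noteq> i" "z i \<noteq> w" using i z[OF i'] by auto
      moreover have "p1 i \<noteq> w" using p1[OF i'] w' by auto
      moreover have "p1 (i - 1) \<noteq> w" if "i \<noteq> 1"
      proof -
        have "i - 1 \<in> {1..s}" using i' that by auto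
        then show ?thesis using p1(1) w' by blast
      qed
      ultimately show ?thesis
        using False op[OF i' w'(2)] oz[OF i'] by (auto simp: inner_y p_def split: if_splits)
    qed
  qed
  have dual_n: "n j \<bullet> y i = (if j = i then 1 else 0)" if i: "i \<in> J" and j: "j \<in> J" for i j
  proof -
    have i': "i \<in> {1..s}" and j': "1 \<le> j" using i j J by auto
    show ?thesis
      using op[OF i' j'] zp[OF i'] zp'[OF i'] oz[OF i'] by (auto simp: inner_y n_def split: if_splits)
  qed
  have \<alpha>_pos: "0 < \<alpha> w" for w
    using k_pos[OF blk_range[of w]] by (simp add: \<alpha>_def)
  note signature = signature_sum_of_squares[of P J \<alpha> "\<lambda>i. 2^i" p y n, folded A_def,
      OF _ finJ \<alpha>_pos _ dual_p dual_n, simplified]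

  \<comment> \<open>\<open>\<sigma> i\<close> and \<open>\<kappa> i\<close> are the coefficients, up
    to the weight \<open>2^i\<close>, of the products one-one and one-zero in block
    \<open>i\<close>.\<close>
  define \<sigma> :: "nat \<Rightarrow> real" where "\<sigma> i = (if i \<in> J \<and> k i = 1 then - 1 else 1)" for i
  define \<kappa> :: "nat \<Rightarrow> real" where "\<kappa> i = (if i \<in> J then \<sigma> i else 1 / k i)" for i
  \<comment> \<open>No product of two 0-vertices is left: outside \<open>J\<close> distinct ones
    have orthogonal vectors, a block with \<open>k i = 1\<close> has only one, and in a hyperbolic
    block they cancel.\<close>
  have block: "(\<Sum>w\<in>{w\<in>P. blk w = i}. \<alpha> w * (p w $ u * p w $ v)) - (if i \<in> J then 2^i * (n i $ u * n i $ v) else 0)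
      = 2^i * (\<sigma> i * (o' i u * o' i v) + \<kappa> i * (o' i u * \<zeta> i v + \<zeta> i u * o' i v))"
    if i: "i \<in> {1..s}" and uv: "u \<noteq> v" for i u v
  proof -
    have k: "1 \<le> k i" using k_pos i .
    consider "i \<notin> J" | "i \<in> J" "k i = 1" | "i \<in> J" "k i \<noteq> 1" by blast
    then show ?thesis
    proof cases
      case 1
      let ?Z = "{w. \<not> one w \<and> blk w = i}"
      have "(\<Sum>w\<in>{w\<in>P. blk w = i}. \<alpha> w * (p w $ u * p w $ v))
          = (\<Sum>w\<in>?Z. 2^i / k i * ((of_bool (u = w) + o' i u) * (of_bool (v = w) + o' i v)))"
        using 1 by (intro sum.cong) (auto simp: P_def \<alpha>_def p_def)
      also have "\<dots> = 2^i / k i * (\<Sum>w\<in>?Z. (of_bool (u = w) + o' i u) * (of_bool (v = w) + o' i v))"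
        by (simp add: sum_distrib_left)
      also have "(\<Sum>w\<in>?Z. (of_bool (u = w) + o' i u) * (of_bool (v = w) + o' i v))
          = (\<Sum>w\<in>?Z. (if u = w then o' i v else 0) + (if v = w then o' i u else 0) + o' i u * o' i v)"
        using uv by (intro sum.cong) (auto simp: algebra_simps)
      also have "\<dots> = \<zeta> i u * o' i v + \<zeta> i v * o' i u + k i * (o' i u * o' i v)"
        using card_zeros[OF i] by (simp add: sum.distrib \<zeta>_def)
      finally show ?thesis using 1 k by (simp add: \<sigma>_def \<kappa>_def field_simps)
    next
      case 2
      then have no_pos: "{w\<in>P. blk w = i} = {}" by (auto simp: P_def)
      have "\<zeta> i u * \<zeta> i v = 0"
      proof -
        obtain w where "{w. \<not> one w \<and> blk w = i} = {w}"
          using card_zeros[OF i] 2 by (metis card_1_singletonE)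
        then have "u = w" if "\<not> one u" "blk u = i" for u using that by blast
        then show ?thesis using uv by (auto simp: \<zeta>_def)
      qed
      then show ?thesis unfolding no_pos using 2
        by (auto simp: \<sigma>_def \<kappa>_def n_def algebra_simps)
    next
      case 3
      then have one_pos: "{w\<in>P. blk w = i} = {z i}" using z[OF i] by (auto simp: P_def)
      show ?thesis unfolding one_pos using 3 z[OF i]
        by (simp add: \<sigma>_def \<kappa>_def n_def \<alpha>_def p_def algebra_simps)
    qed
  qed
  have entry: "A $ u $ v = (\<Sum>i=1..s. 2^i * (\<sigma> i * (o' i u * o' i v) + \<kappa> i * (o' i u * \<zeta> i v + \<zeta> i u * o' i v)))"
    if "u \<noteq> v" for u v
  proof -
    have "(\<Sum>w\<in>P. \<alpha> w * (p w $ u * p w $ v)) = (\<Sum>i=1..s. \<Sum>w\<in>{w\<in>P. blk w = i}. \<alpha> w * (p w $ u * p w $ v))"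
      using blk_range by (intro sum.group[symmetric]) auto
    moreover have "(\<Sum>i\<in>J. 2^i * (n i $ u * n i $ v)) = (\<Sum>i=1..s. if i \<in> J then 2^i * (n i $ u * n i $ v) else 0)"
      using J by (simp add: sum.If_cases Int_absorb1)
    ultimately have "A $ u $ v = (\<Sum>i=1..s. (\<Sum>w\<in>{w\<in>P. blk w = i}. \<alpha> w * (p w $ u * p w $ v))
        - (if i \<in> J then 2^i * (n i $ u * n i $ v) else 0))"
      by (simp add: A_def sum_subtractf)
    then show ?thesis using block[OF _ that] by simp
  qed
  have entry_one_zero: "A $ u $ v \<noteq> 0 \<longleftrightarrow> blk v \<le> blk u" if "one u" "\<not> one v" for u v
  proof -
    have "u \<noteq> v" using that by blast
    have "A $ u $ v = (\<Sum>i=1..s. if i = blk v then 2^i * (\<kappa> i * of_bool (i \<le> blk u)) else 0)"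
      unfolding entry[OF \<open>u \<noteq> v\<close>] using that
      by (intro sum.cong refl) (auto simp: o'_def \<zeta>_def)
    also have "\<dots> = 2^blk v * (\<kappa> (blk v) * of_bool (blk v \<le> blk u))"
      using blk_range[of v] by simp
    finally show ?thesis using k_pos[OF blk_range[of v]] by (auto simp: \<kappa>_def \<sigma>_def)
  qed
  have entry_ones: "A $ u $ v \<noteq> 0" if "one u" "one v" "u \<noteq> v" for u v
  proof -
    let ?m = "min (blk u) (blk v)"
    have "A $ u $ v = (\<Sum>i=1..s. if i \<le> ?m then \<sigma> i * 2^i else 0)"
      unfolding entry[OF that(3)] using that(1,2)
      by (intro sum.cong refl) (auto simp: o'_def \<zeta>_def)
    also have "\<dots> = (\<Sum>i=1..?m. \<sigma> i * 2^i)"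
      using blk_range[of u] by (intro sum.mono_neutral_cong_right) auto
    also have "\<dots> \<noteq> 0"
      using blk_range[of u] blk_range[of v] by (intro sum_signed_powers_of_2_nonzero) (auto simp: \<sigma>_def)
    finally show ?thesis .
  qed
  have entry_zeros: "A $ u $ v = 0" if "\<not> one u" "\<not> one v" "u \<noteq> v" for u v
    using that by (subst entry) (auto simp: o'_def)
  have sym: "A $ u $ v = A $ v $ u" for u v
    using signature(1) by (metis transpose_def vec_lambda_beta)
  have "A $ u $ v \<noteq> 0 \<longleftrightarrow> E u v" if "u \<noteq> v" for u v
    using adjacent[OF that] entry_one_zero[of u v] entry_one_zero[of v u] sym[of u v]
      entry_ones[of u v] entry_zeros[of u v] that
    by (cases "one u"; cases "one v") simp_all
  then have "A \<in> S_q (card J) E"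
    using signature(1,2) by (simp add: S_q_def symmetric_matrices_of_def)
  moreover have "(\<Sum>i=1..s. t i) + (\<Sum>i\<in>J. k i - 2) \<le> nullity A"
  proof -
    have "card P = (\<Sum>i=1..s. card {w\<in>P. blk w = i})"
    proof -
      have "P = (\<Union>i\<in>{1..s}. {w\<in>P. blk w = i})" using blk_range by auto
      then have "card P = card (\<Union>i\<in>{1..s}. {w\<in>P. blk w = i})" by simp
      also have "\<dots> = (\<Sum>i=1..s. card {w\<in>P. blk w = i})" by (intro card_UN_disjoint) auto
      finally show ?thesis .
    qed
    also have "\<dots> = (\<Sum>i=1..s. if i \<in> J then of_bool (k i \<noteq> 1) else k i)"
    proof (intro sum.cong refl)
      fix i assume i: "i \<in> {1..s}"
      show "card {w\<in>P. blk w = i} = (if i \<in> J then of_bool (k i \<noteq> 1) else k i)"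
      proof (cases "i \<in> J")
        case True
        then have "{w\<in>P. blk w = i} = (if k i \<noteq> 1 then {z i} else {})"
          using z[OF i] by (auto simp: P_def)
        then show ?thesis using True by simp
      next
        case False
        then have "{w\<in>P. blk w = i} = {w. \<not> one w \<and> blk w = i}" by (auto simp: P_def)
        then show ?thesis using False card_zeros[OF i] by simp
      qed
    qed
    finally have card_P: "card P = (\<Sum>i=1..s. if i \<in> J then of_bool (k i \<noteq> 1) else k i)" .
    have "card J + (\<Sum>i\<in>J. k i - 2) = (\<Sum>i\<in>J. 1 + (k i - 2))"
      by (simp only: sum.distrib card_eq_sum)
    also have "\<dots> = (\<Sum>i=1..s. if i \<in> J then 1 + (k i - 2) else 0)"
      using J by (simp only: sum.If_cases finite_atLeastAtMost Collect_mem_eq Int_absorb1 sum.neutral_const add_0_right)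
    finally have "card P + (card J + (\<Sum>i\<in>J. k i - 2))
        = (\<Sum>i=1..s. (if i \<in> J then of_bool (k i \<noteq> 1) else k i) + (if i \<in> J then 1 + (k i - 2) else 0))"
      unfolding card_P by (simp only: sum.distrib)
    \<comment> \<open>In \<open>J\<close> the summand is \<open>1 + 1 + (k i - 2)\<close>, or
      \<open>0 + 1 + 0\<close> for \<open>k i = 1\<close>, where the subtraction truncates.\<close>
    also have "\<dots> = (\<Sum>i=1..s. k i)"
      using k_pos by (intro sum.cong) (auto simp: of_bool_def, force+)
    finally have "card P + (card J + (\<Sum>i\<in>J. k i - 2)) = (\<Sum>i=1..s. k i)" .
    moreover have "CARD('v) = (\<Sum>i=1..s. t i) + (\<Sum>i=1..s. k i)"
    proof -
      have "{v. \<not> one v} = (\<Union>i\<in>{1..s}. {v. \<not> one v \<and> blk v = i})" using blk_range by auto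
      then have "card {v. \<not> one v} = (\<Sum>i\<in>{1..s}. card {v. \<not> one v \<and> blk v = i})"
        by (simp only:) (intro card_UN_disjoint, auto)
      moreover have "CARD('v) = card {v. one v} + card {v. \<not> one v}"
      proof -
        have "(UNIV :: 'v set) = {v. one v} \<union> {v. \<not> one v}" by blast
        then have "CARD('v) = card ({v. one v} \<union> {v. \<not> one v})" by simp
        also have "\<dots> = card {v. one v} + card {v. \<not> one v}" by (intro card_Un_disjoint) auto
        finally show ?thesis .
      qed
      ultimately show ?thesis using card_all_ones card_zeros by simp
    qed
    ultimately show ?thesis using signature(3) by linarith
  qed
  ultimately show ?thesis by blast
qed

end

theorem theorem3p4:
  fixes E :: "'v::finite \<Rightarrow> 'v \<Rightarrow> bool"
    and k t a :: "nat \<Rightarrow> nat" and s T q :: nat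
  assumes "s \<ge> 1"
    and "\<forall>i\<in>{1..s}. k i \<ge> 1 \<and> t i \<ge> 1"
    and "has_creation_sequence E (block_sequence s k t)"
    and "T = (\<Sum>i=1..s. t i)"
    and "\<forall>j\<in>{1..s}. int (a j) = max (int (k j) - 2) 0"
    and "q \<le> s"
  shows "M_q q E = Z_q q E \<and>
         Z_q q E = T + Max {\<Sum>j\<in>J. a j | J. J \<subseteq> {1..s} \<and> card J = q}"
proof -
  obtain blk one where "threshold_blocks E blk one s k t"
    using creation_sequence_blocks[OF assms(3,2)] .
  then interpret threshold_blocks E blk one s k t .
  have a: "a j = k j - 2" if "j \<in> {1..s}" for j
    using bspec[OF assms(5) that] by (auto simp: max_def split: if_splits)
  let ?S = "{\<Sum>j\<in>J. a j | J. J \<subseteq> {1..s} \<and> card J = q}"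
  have fin: "finite ?S"
  proof -
    have "?S \<subseteq> sum a ` Pow {1..s}" by blast
    then show ?thesis by (rule finite_subset) simp
  qed
  \<comment> \<open>The strategy meets at most \<open>q\<close> blocks, the maximum ranges over
    exactly \<open>q\<close>. As \<open>a\<close> is nonnegative and \<open>q \<le> s\<close>, the
    set of blocks can be enlarged.\<close>
  have max: "sum a J \<le> Max ?S" if "J \<subseteq> {1..s}" "card J \<le> q" for J
  proof -
    have "\<exists>J'. J \<subseteq> J' \<and> J' \<subseteq> {1..s} \<and> card J' = q"
      using that assms(6) by (intro exists_subset_between) auto
    then obtain J' where J': "J \<subseteq> J'" "J' \<subseteq> {1..s}" "card J' = q" by blast
    then have "sum a J \<le> sum a J'" by (meson finite_atLeastAtMost finite_subset sum_mono2 zero_le)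
    also have "\<dots> \<le> Max ?S" using fin J' by (intro Max_ge) auto
    finally show ?thesis .
  qed
  have win: "Zq_win q E (T + Max ?S) {}"
    unfolding assms(4) by (rule Zq_win_empty[where a = a]) (use a max in auto)
  then have "Z_q q E \<le> T + Max ?S" unfolding Z_q_def by (rule Least_le)
  moreover have le: "nullity A \<le> Z_q q E" if "A \<in> S_q q E" for A
    using nullity_le_Z_q[OF win that] .
  moreover have "?S \<noteq> {}"
    using max[of "{}"] exists_subset_between[of "{}" q "{1..s}"] assms(6) by auto
  then have "Max ?S \<in> ?S" using fin by (intro Max_in)
  then obtain J where J: "J \<subseteq> {1..s}" "card J = q" "Max ?S = sum a J" by blast
  obtain A where A: "A \<in> S_q q E" "T + Max ?S \<le> nullity A"
  proof -
    have "sum a J = (\<Sum>j\<in>J. k j - 2)" using a J(1) by (intro sum.cong) auto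
    then show thesis using ex_matrix[OF J(1)] that J(2,3) assms(4) by auto
  qed
  \<comment> \<open>The upper bound makes the set of nullities finite and \<open>A\<close> makes it
    nonempty, so the \<open>Max\<close> in \<open>M_q\<close> is a genuine maximum.\<close>
  have "finite (nullity ` S_q q E)" by (rule finite_subset[of _ "{..Z_q q E}"]) (use le in auto)
  then have "nullity A \<le> M_q q E" "M_q q E \<le> Z_q q E"
    unfolding M_q_def using A(1) le by (auto intro: Max_ge Max.boundedI)
  ultimately show ?thesis using A(2) by linarith
qed

end
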